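(* Assume that $\mathbb{V}\in\mathcal{V}$, that $\mathbb{V}_1,\mathbb{V}_2\in\mathcal{V}_\infty$, and that $c\ge 1$ is a real number. Then (each formula denoting the function of the variable $m$): (1) $\mathbb{V}(m/c)\in\mathcal{V}$; (2) for any $a\in\mathbb{R}$, $\mathbb{V}(m)+am\in\mathcal{V}$ and $\mathbb{V}_1(m)+am\in\mathcal{V}_\infty$; (3) $\mathbb{V}_1(m)+\mathbb{V}_2(m)-1\in\mathcal{V}_\infty$ and $c\,\mathbb{V}_1(m)-c+1\in\mathcal{V}_\infty$; (4) $\mathbb{V}_1(m)-m^2\in\mathcal{V}$; (5) $\mathbb{V}(m)+m^2\in\mathcal{V}_\infty$.
   Context: Let $\nu$ be a non-degenerate compactly supported probability measure on $\mathbb{R}$ with $\int x\,\nu(dx)=0$. The variance function $\mathbb{V}_\nu$ of the Cauchy-Stieltjes Kernel (CSK) family generated by $\nu$ is the unique function $\mathbb{V}$, real analytic in a neighbourhood of $0$ with $\mathbb{V}(0)\neq 0$, such that for all $m$ in some open interval $(m_-,m_+)$ containing $0$ the formula $$Q_m(dx)=f(x,m)\,\nu(dx),\qquad f(x,m)=\frac{\mathbb{V}(m)}{\mathbb{V}(m)+m(m-x)}\ (m\ne 0),\quad f(x,0)=1,$$ defines a probability measure. (Existence and uniqueness are known; one then has $\int x\,Q_m(dx)=m$ and $\mathbb{V}(m)=\int (x-m)^2 Q_m(dx)$, so $\mathbb{V}_\nu(0)=\int x^2\nu(dx)$.) Variance functions are regarded as germs at $0$: two functions that agree near $0$ are identified.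 $\mathcal{V}$ denotes the class of variance functions $\mathbb{V}_\nu$ where $\nu$ is a compactly supported probability measure on $\mathbb{R}$ with $\int x\,\nu(dx)=0$ and $\int x^2\nu(dx)=1$ (so $\mathbb{V}_\nu(0)=1$). $\mathcal{V}_\infty$ denotes the class of those $\mathbb{V}\in\mathcal{V}$ such that the function $m\mapsto \mathbb{V}(cm)$ is in $\mathcal{V}$ for every real $c$. *)

theory Defs
  imports "HOL-Probability.Probability"
begin

definition real_analytic_at :: "(real \<Rightarrow> real) \<Rightarrow> real \<Rightarrow> bool" where
  "real_analytic_at f a \<longleftrightarrow> (\<exists>F. (\<lambda>h. f (a + h)) has_fps_expansion F)"

definition csk_density :: "(real \<Rightarrow> real) \<Rightarrow> real \<Rightarrow> real \<Rightarrow> real" where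
  "csk_density V x m = (if m = 0 then 1 else V m / (V m + m * (m - x)))"

(* The nonnegativity clause is needed because ennreal truncates negative reals to 0: without it
   a signed density could pass as the density of a probability measure. *)
definition csk_member_prob :: "real measure \<Rightarrow> (real \<Rightarrow> real) \<Rightarrow> real \<Rightarrow> bool" where
  "csk_member_prob \<nu> V m \<longleftrightarrow>
     (AE x in \<nu>. 0 \<le> csk_density V x m) \<and>
     prob_space (density \<nu> (\<lambda>x. ennreal (csk_density V x m)))"

(* V represents the variance function of the CSK family generated by \<nu>. Only the germ of V at 0
   is determined by \<nu>, and the predicate depends only on that germ; it is therefore a relation
   between measures and total functions, and values of V far from 0 are irrelevant.
   Since V is continuous near 0 with V 0 \<noteq> 0, and \<nu> will have bounded support, the denominator in
   csk_density is bounded away from 0 for small m, so division by zero plays no role. *)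
definition variance_function :: "real measure \<Rightarrow> (real \<Rightarrow> real) \<Rightarrow> bool" where
  "variance_function \<nu> V \<longleftrightarrow>
     (\<forall>\<^sub>F a in nhds 0. real_analytic_at V a) \<and> V 0 \<noteq> 0 \<and>
     (\<exists>m1 m2. m1 < 0 \<and> 0 < m2 \<and> (\<forall>m\<in>{m1<..<m2}. csk_member_prob \<nu> V m))"

definition compactly_supported :: "real measure \<Rightarrow> bool" where
  "compactly_supported \<nu> \<longleftrightarrow> (\<exists>K. compact K \<and> (AE x in \<nu>. x \<in> K))"

(* Integrability of x and x^2 is automatic under compact support; variance 1 makes \<nu>
   non-degenerate. *)
definition variance_class :: "(real \<Rightarrow> real) set" where
  "variance_class = {V. \<exists>\<nu>. real_distribution \<nu> \<and> compactly_supported \<nu> \<and>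
     (\<integral>x. x \<partial>\<nu>) = 0 \<and> (\<integral>x. x\<^sup>2 \<partial>\<nu>) = 1 \<and> variance_function \<nu> V}"

definition variance_class_inf :: "(real \<Rightarrow> real) set" where
  "variance_class_inf = {V \<in> variance_class. \<forall>c. (\<lambda>m. V (c * m)) \<in> variance_class}"

end

theory Submission
  imports Defs "HOL-Complex_Analysis.Laurent_Convergence" "HOL-Real_Asymp.Real_Asymp"
begin

text \<open>
  Everything follows from a description of the two classes by free cumulants. Let \<open>\<nu>\<close> have
  mean 0 and variance 1, with moment series \<open>M\<close>, and strip off the first step of its continued
  fraction: \<open>M = 1 / (1 - z\<^sup>2 T)\<close>, where \<open>T\<close> is the moment series of another compactly supported
  probability measure \<open>\<omega>\<close>, and every such \<open>\<omega>\<close> arises. Integrating the density shows that the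
  CSK condition is \<open>M(u) (1 - m u) = 1\<close> for \<open>u = m / (V(m) + m\<^sup>2)\<close>, which in terms of \<open>T\<close> reads
  \<open>u T(u) = m\<close>. Hence \<open>C(m) = V(m) + m\<^sup>2\<close> satisfies \<open>C(z T(z)) = T(z)\<close>, that is, \<open>C(m) = 1 + m R(m)\<close>
  with \<open>R\<close> the R-transform of \<open>\<omega>\<close>. So if \<open>\<C>\<close> denotes the set of all series \<open>1 + m R(m)\<close> belonging
  to compactly supported probability measures, then \<open>V\<close> is a variance function iff
  \<open>V + m\<^sup>2 \<in> \<C>\<close> (\<open>variance_class_iff\<close>), and it lies in the smaller class iff \<open>V \<in> \<C>\<close>
  (\<open>variance_class_inf_iff\<close>).

  With that, the statements on \<open>V1 - m\<^sup>2\<close> and \<open>V + m\<^sup>2\<close> are immediate, and the others are closure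
  properties of \<open>\<C>\<close>:
  \<open>C1 + C2 - 1 \<in> \<C>\<close> (free additive convolution, \<open>free_cumulant_class_add\<close>),
  \<open>c C - (c - 1) \<in> \<C>\<close> for \<open>c \<ge> 1\<close> (free convolution powers, \<open>free_cumulant_class_power\<close>),
  \<open>C(c m) \<in> \<C>\<close> (dilation), and \<open>1 + a m\<close>, \<open>1 + v m\<^sup>2 \<in> \<C>\<close> (point masses and semicircle laws).
  For \<open>V(m / c)\<close>, a dilation by \<open>1/c\<close> turns \<open>m\<^sup>2\<close> into \<open>m\<^sup>2/c\<^sup>2\<close>, and adding a semicircle law of variance
  \<open>1 - 1/c\<^sup>2\<close> restores it. For the smaller class, \<open>V(k m) + m\<^sup>2 \<in> \<C>\<close> gives
  \<open>V(m) + m\<^sup>2/k\<^sup>2 \<in> \<C>\<close> after a dilation, and \<open>k \<longrightarrow> \<infinity>\<close> gives \<open>V \<in> \<C>\<close>.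

  The two convolution theorems are proved at the level of formal power series. The series \<open>M\<close> with the
  wanted cumulants always exists; what has to be shown is that its Hankel forms are positive.
  Subordination presents \<open>M\<close>, and the auxiliary series \<open>S\<close> on which it depends, as values of the
  operation \<open>R, D \<mapsto> \<integral> 1 / (D - x z) d\<rho>(x)\<close>, where \<open>\<rho>\<close> is a fixed measure with moment series
  \<open>R\<close> and \<open>D = 1 - a z - b z\<^sup>2 S\<close>. A continued fraction step and a mixture both preserve
  positivity, and coefficient \<open>n\<close> of the result involves only coefficients of \<open>S\<close> of lower order, so
  positivity of \<open>S\<close> and then of \<open>M\<close> follows by induction on the number of coefficients matched.
  Geometric growth of the coefficients of \<open>M\<close> is inherited from \<open>C\<close>, and the bounded moment
  problem (\<open>bounded_Hamburger\<close>) turns positive series of positive radius of convergence back into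
  measures.
\<close>

unbundle no vec_syntax

section \<open>Positive moment sequences\<close>

text \<open>
  The linear functional on polynomials that sends \<open>X\<^sup>n\<close> to the coefficient \<open>M $ n\<close>: integration against
  a measure with moment series \<open>M\<close>, if there is one.
\<close>

definition moment_functional :: "real fps \<Rightarrow> real poly \<Rightarrow> real" where
  "moment_functional M p = (\<Sum>i\<le>degree p. coeff p i * M $ i)"

definition positive_moments :: "real fps \<Rightarrow> bool" where
  "positive_moments M \<longleftrightarrow> M $ 0 = 1 \<and> (\<forall>p. 0 \<le> moment_functional M (p * p))"

lemma moment_functional_altdef:
  assumes "degree p \<le> N"
  shows "moment_functional M p = (\<Sum>i\<le>N. coeff p i * M $ i)"
  unfolding moment_functional_def
  by (rule sum.mono_neutral_left) (use assms in \<open>auto simp: coeff_eq_0\<close>)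

lemma moment_functional_0 [simp]: "moment_functional M 0 = 0"
  by (simp add: moment_functional_def)

lemma moment_functional_monom [simp]: "moment_functional M (monom c n) = c * M $ n"
  by (subst moment_functional_altdef[OF degree_monom_le]) (simp add: coeff_monom if_distrib if_distribR cong: if_cong)

lemma moment_functional_1 [simp]: "moment_functional M 1 = M $ 0"
  using moment_functional_monom[of M 1 0] by (simp del: moment_functional_monom)

lemma moment_functional_add: "moment_functional M (p + q) = moment_functional M p + moment_functional M q"
  by (simp add: moment_functional_altdef[of "p + q" "max (degree p) (degree q)"] degree_add_le
      moment_functional_altdef[of p "max (degree p) (degree q)"]
      moment_functional_altdef[of q "max (degree p) (degree q)"] sum.distrib algebra_simps)

lemma moment_functional_smult: "moment_functional M (smult c p) = c * moment_functional M p"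
  by (simp add: moment_functional_altdef[of "smult c p" "degree p"] degree_smult_le
      moment_functional_def sum_distrib_left mult.assoc)

lemma moment_functional_uminus: "moment_functional M (- p) = - moment_functional M p"
  using moment_functional_smult[of M "-1" p] by simp

lemma moment_functional_diff: "moment_functional M (p - q) = moment_functional M p - moment_functional M q"
  using moment_functional_add[of M p "- q"] by (simp add: moment_functional_uminus)

lemma moment_functional_numeral_mult: "moment_functional M (numeral k * p) = numeral k * moment_functional M p"
  by (simp add: numeral_poly moment_functional_smult)

lemma moment_functional_sum: "moment_functional M (\<Sum>i\<in>A. f i) = (\<Sum>i\<in>A. moment_functional M (f i))"
  by (induction A rule: infinite_finite_induct) (simp_all add: moment_functional_add)

lemmas moment_functional_linear =
  moment_functional_add moment_functional_diff moment_functional_smult moment_functional_uminus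
  moment_functional_sum

lemma moment_functional_const: "moment_functional M [:c:] = c * M $ 0"
  using moment_functional_monom[of M c 0] by (simp add: monom_0 del: moment_functional_monom)

lemma moment_functional_square:
  "moment_functional M (p * p) =
     (\<Sum>i\<le>degree p. \<Sum>j\<le>degree p. coeff p i * coeff p j * M $ (i + j))"
proof -
  have p: "p = (\<Sum>i\<le>degree p. monom (coeff p i) i)"
    by (rule poly_as_sum_of_monoms[symmetric])
  have "p * p = (\<Sum>i\<le>degree p. \<Sum>j\<le>degree p. monom (coeff p i * coeff p j) (i + j))"
    by (subst p, subst (2) p) (simp add: sum_product mult_monom)
  thus ?thesis by (simp add: moment_functional_sum)
qed

lemma positive_momentsI:
  assumes "M $ 0 = 1"
    and "\<And>c n. 0 \<le> (\<Sum>i\<le>n. \<Sum>j\<le>n. c i * c j * M $ (i + j))"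
  shows "positive_moments M"
  using assms by (simp add: positive_moments_def moment_functional_square)

lemma positive_moments_0: "positive_moments M \<Longrightarrow> M $ 0 = 1"
  by (simp add: positive_moments_def)

lemma positive_moments_square: "positive_moments M \<Longrightarrow> 0 \<le> moment_functional M (p * p)"
  by (simp add: positive_moments_def)

lemma positive_moments_quadratic_form:
  fixes n :: nat and c :: "nat \<Rightarrow> real"
  assumes "positive_moments M"
  shows "0 \<le> (\<Sum>i\<le>n. \<Sum>j\<le>n. c i * c j * M $ (i + j))"
proof -
  let ?p = "\<Sum>i\<le>n. monom (c i) i"
  have "?p * ?p = (\<Sum>i\<le>n. \<Sum>j\<le>n. monom (c i * c j) (i + j))"
    by (simp add: sum_product mult_monom)
  hence "moment_functional M (?p * ?p) = (\<Sum>i\<le>n. \<Sum>j\<le>n. c i * c j * M $ (i + j))"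
    by (simp add: moment_functional_sum)
  thus ?thesis using positive_moments_square[OF assms, of ?p] by simp
qed

text \<open>
  Each Hankel form looks at finitely many coefficients only.
\<close>

lemma positive_moments_agree:
  assumes "\<And>n. \<exists>T. positive_moments T \<and> (\<forall>i<n. T $ i = M $ i)"
  shows "positive_moments M"
proof (rule positive_momentsI)
  obtain T where "positive_moments T" "\<forall>i<1. T $ i = M $ i"
    using assms[of 1] by blast
  thus "M $ 0 = 1" using positive_moments_0[of T] by simp
next
  fix c :: "nat \<Rightarrow> real" and n
  obtain T where T: "positive_moments T" "\<forall>i<2*n+1. T $ i = M $ i"
    using assms[of "2*n+1"] by blast
  have "(\<Sum>i\<le>n. \<Sum>j\<le>n. c i * c j * M $ (i + j)) = (\<Sum>i\<le>n. \<Sum>j\<le>n. c i * c j * T $ (i + j))"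
    by (intro sum.cong refl) (use T in auto)
  thus "0 \<le> (\<Sum>i\<le>n. \<Sum>j\<le>n. c i * c j * M $ (i + j))"
    using positive_moments_quadratic_form[OF T(1), of c n] by simp
qed

lemma positive_moments_LIMSEQ:
  assumes "\<And>k. positive_moments (T k)" "\<And>n. (\<lambda>k. T k $ n) \<longlonglongrightarrow> M $ n"
  shows "positive_moments M"
proof (rule positive_momentsI)
  have "(\<lambda>k. T k $ 0) \<longlonglongrightarrow> 1"
    using assms(1) by (simp add: positive_moments_0)
  thus "M $ 0 = 1" using assms(2)[of 0] LIMSEQ_unique by blast
next
  fix c :: "nat \<Rightarrow> real" and n
  have "(\<lambda>k. \<Sum>i\<le>n. \<Sum>j\<le>n. c i * c j * T k $ (i + j))
          \<longlonglongrightarrow> (\<Sum>i\<le>n. \<Sum>j\<le>n. c i * c j * M $ (i + j))"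
    by (intro tendsto_intros assms)
  thus "0 \<le> (\<Sum>i\<le>n. \<Sum>j\<le>n. c i * c j * M $ (i + j))"
    by (rule LIMSEQ_le_const) (use positive_moments_quadratic_form[OF assms(1)] in auto)
qed

lemma positive_moments_dilation:
  assumes "positive_moments M"
  shows "positive_moments (M oo (fps_const r * fps_X))"
proof (rule positive_momentsI)
  show "(M oo (fps_const r * fps_X)) $ 0 = 1"
    using assms by (simp add: positive_moments_0)
next
  fix c :: "nat \<Rightarrow> real" and n
  have nth: "(M oo (fps_const r * fps_X)) $ k = r ^ k * M $ k" for k
    by (simp only: fps_compose_linear fps_nth_Abs_fps)
  have "(\<Sum>i\<le>n. \<Sum>j\<le>n. c i * c j * (M oo (fps_const r * fps_X)) $ (i + j))
      = (\<Sum>i\<le>n. \<Sum>j\<le>n. (c i * r ^ i) * (c j * r ^ j) * M $ (i + j))"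
    by (simp only: nth power_add) (simp only: mult_ac)
  thus "0 \<le> (\<Sum>i\<le>n. \<Sum>j\<le>n. c i * c j * (M oo (fps_const r * fps_X)) $ (i + j))"
    using positive_moments_quadratic_form[OF assms, of "\<lambda>i. c i * r ^ i" n] by simp
qed

lemma positive_moments_dirac:
  "positive_moments (Abs_fps (\<lambda>n. x ^ n))"
proof (rule positive_momentsI)
  fix c :: "nat \<Rightarrow> real" and n
  have "(\<Sum>i\<le>n. \<Sum>j\<le>n. c i * c j * Abs_fps (\<lambda>n. x ^ n) $ (i + j)) = (\<Sum>i\<le>n. c i * x ^ i)\<^sup>2"
    by (simp add: power2_eq_square sum_product power_add algebra_simps)
  thus "0 \<le> (\<Sum>i\<le>n. \<Sum>j\<le>n. c i * c j * Abs_fps (\<lambda>n. x ^ n) $ (i + j))" by simp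
qed simp

lemma positive_moments_1: "positive_moments 1"
proof -
  have "Abs_fps (\<lambda>n. 0 ^ n) = (1 :: real fps)"
    by (simp add: fps_eq_iff)
  thus ?thesis using positive_moments_dirac[of 0] by simp
qed

section \<open>One step of a continued fraction\<close>

text \<open>
  Decomposing a walk at its first return to the origin: weight \<open>a\<close> for a step that stays, and weight
  \<open>b\<close> times \<open>T\<close> for an excursion.
\<close>

lemma first_return_recursion:
  fixes S T :: "real fps"
  shows "S * (1 - fps_const a * fps_X - fps_const b * fps_X\<^sup>2 * T) = 1 \<longleftrightarrow>
    S $ 0 = 1 \<and> (\<forall>n. S $ Suc n = a * S $ n + b * (\<Sum>k<n. S $ (n - Suc k) * T $ k))"
proof -
  let ?R = "1 + fps_const a * (fps_X * S) + fps_const b * (fps_X\<^sup>2 * (T * S))"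
  have "S * (1 - fps_const a * fps_X - fps_const b * fps_X\<^sup>2 * T) = 1 \<longleftrightarrow> S = ?R"
    by (auto simp: algebra_simps)
  also have "\<dots> \<longleftrightarrow> S $ 0 = ?R $ 0 \<and> (\<forall>n. S $ Suc n = ?R $ Suc n)"
    unfolding fps_eq_iff using not0_implies_Suc by metis
  also have "\<dots> \<longleftrightarrow> S $ 0 = 1 \<and> (\<forall>n. S $ Suc n = a * S $ n + b * (\<Sum>k<n. S $ (n - Suc k) * T $ k))"
  proof -
    have "(fps_X\<^sup>2 * (T * S)) $ Suc n = (\<Sum>k<n. S $ (n - Suc k) * T $ k)" for n
    proof (cases n)
      case (Suc m)
      have "(T * S) $ m = (\<Sum>k\<le>m. S $ (m - k) * T $ k)"
        by (subst fps_mult_nth) (simp add: atLeast0AtMost mult.commute)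
      thus ?thesis using Suc by (simp add: fps_X_power_mult_nth lessThan_Suc_atMost)
    qed (simp add: fps_X_power_mult_nth)
    thus ?thesis by (simp add: fps_X_mult_nth fps_X_power_mult_nth)
  qed
  finally show ?thesis .
qed

text \<open>
  Let \<open>e\<close> be a new unit vector orthogonal to the polynomials with the form of \<open>T\<close>, and let the operator
  \<open>J\<close> act by \<open>J e = a e + \<surd>b 1\<close> and \<open>J p = X p + \<surd>b L(p) e\<close>. It is symmetric and
  \<open>S $ n\<close> is the inner product of \<open>J\<^sup>n e\<close> and \<open>e\<close>, so the Hankel form of \<open>S\<close> is the squared norm of
  \<open>\<Sum> c i J\<^sup>i e\<close>. In the proof, \<open>J\<^sup>n e\<close> is \<open>S $ n e + \<surd>b P n\<close>, and \<open>g i j\<close> is the inner product of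
  \<open>J\<^sup>i e\<close> and \<open>J\<^sup>j e\<close>; symmetry of \<open>J\<close> is the fact called \<open>shift\<close>.
\<close>

lemma positive_moments_first_return:
  assumes T: "positive_moments T" and "b \<ge> 0"
    and S: "S * (1 - fps_const a * fps_X - fps_const b * fps_X\<^sup>2 * T) = 1"
  shows "positive_moments S"
proof -
  let ?L = "moment_functional T"
  define P :: "nat \<Rightarrow> real poly" where "P n = (\<Sum>k<n. monom (S $ (n - Suc k)) k)" for n
  have S0: "S $ 0 = 1" and S_Suc: "S $ Suc n = a * S $ n + b * ?L (P n)" for n
    using S by (auto simp: first_return_recursion P_def moment_functional_sum)
  have P_0: "P 0 = 0" by (simp add: P_def)
  have P_Suc: "P (Suc n) = [:S $ n:] + monom 1 1 * P n" for n
    unfolding P_def by (subst sum.lessThan_Suc_shift) (simp add: monom_0 sum_distrib_left mult_monom)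
  define g where "g i j = S $ i * S $ j + b * ?L (P i * P j)" for i j
  have g_Suc: "g (Suc i) j = a * S $ i * S $ j + b * S $ j * ?L (P i) + b * S $ i * ?L (P j)
                 + b * ?L (monom 1 1 * (P i * P j))" for i j
    by (simp add: g_def S_Suc P_Suc moment_functional_linear algebra_simps)
  have "g i (Suc j) = g (Suc j) i" for i j
    by (simp add: g_def mult.commute)
  hence shift: "g (Suc i) j = g i (Suc j)" for i j
    by (simp add: g_Suc mult.commute mult.left_commute)
  have g: "g i j = S $ (i + j)" for i j
  proof (induction i arbitrary: j)
    case 0
    show ?case by (simp add: g_def P_0 S0)
  next
    case (Suc i)
    show ?case by (simp add: shift Suc)
  qed
  show ?thesis
  proof (rule positive_momentsI[OF S0])
    fix c :: "nat \<Rightarrow> real" and n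
    let ?Q = "\<Sum>i\<le>n. smult (c i) (P i)"
    have "?L (?Q * ?Q) = (\<Sum>i\<le>n. \<Sum>j\<le>n. ?L (smult (c i) (P i) * smult (c j) (P j)))"
      by (simp only: sum_product moment_functional_sum)
    also have "\<dots> = (\<Sum>i\<le>n. \<Sum>j\<le>n. c i * c j * ?L (P i * P j))"
      by (intro sum.cong refl) (simp add: moment_functional_smult)
    finally have "?L (?Q * ?Q) = (\<Sum>i\<le>n. \<Sum>j\<le>n. c i * c j * ?L (P i * P j))" .
    moreover have "(\<Sum>i\<le>n. c i * S $ i)\<^sup>2 = (\<Sum>i\<le>n. \<Sum>j\<le>n. c i * c j * (S $ i * S $ j))"
      by (simp add: power2_eq_square sum_product algebra_simps)
    moreover have "(\<Sum>i\<le>n. \<Sum>j\<le>n. c i * c j * S $ (i + j))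
        = (\<Sum>i\<le>n. \<Sum>j\<le>n. c i * c j * (S $ i * S $ j)) + b * (\<Sum>i\<le>n. \<Sum>j\<le>n. c i * c j * ?L (P i * P j))"
    proof -
      have "(\<Sum>i\<le>n. \<Sum>j\<le>n. c i * c j * S $ (i + j))
          = (\<Sum>i\<le>n. \<Sum>j\<le>n. c i * c j * (S $ i * S $ j) + b * (c i * c j * ?L (P i * P j)))"
        by (simp only: g[symmetric] g_def) (intro sum.cong refl, simp add: algebra_simps)
      thus ?thesis by (simp only: sum.distrib sum_distrib_left)
    qed
    ultimately have "(\<Sum>i\<le>n. \<Sum>j\<le>n. c i * c j * S $ (i + j)) = (\<Sum>i\<le>n. c i * S $ i)\<^sup>2 + b * ?L (?Q * ?Q)"
      by simp
    thus "0 \<le> (\<Sum>i\<le>n. \<Sum>j\<le>n. c i * c j * S $ (i + j))"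
      using \<open>b \<ge> 0\<close> positive_moments_square[OF T, of ?Q] by simp
  qed
qed

text \<open>
  Cauchy-Schwarz for a vector of length 0: otherwise the form would be linear and nonconstant
  along a line, and hence negative somewhere.
\<close>

lemma moment_functional_null_square:
  assumes M: "positive_moments M" and "moment_functional M (p * p) = 0"
  shows "moment_functional M (p * q) = 0"
proof (rule ccontr)
  let ?L = "moment_functional M"
  assume ne: "?L (p * q) \<noteq> 0"
  \<comment> \<open>chosen so that the form takes the value \<open>-1\<close> at \<open>t p + q\<close>\<close>
  define t where "t = - (?L (q * q) + 1) / (2 * ?L (p * q))"
  have "(smult t p + q) * (smult t p + q) = smult (t * t) (p * p) + (smult t (p * q) + smult t (p * q)) + q * q"
    by (simp add: algebra_simps)
  hence "?L ((smult t p + q) * (smult t p + q)) = 2 * t * ?L (p * q) + ?L (q * q)"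
    using assms(2) by (simp add: moment_functional_linear moment_functional_numeral_mult)
  also have "\<dots> = -1" using ne by (simp add: t_def field_simps)
  finally show False using positive_moments_square[OF M, of "smult t p + q"] by simp
qed

text \<open>
  The converse step compresses multiplication by \<open>X\<close> to the orthogonal complement of the constants.
  The polynomials \<open>Q n\<close> are the orbit of \<open>X - a\<close> under that compression, which is again symmetric, so
  \<open>b T $ n = L(Q 0 Q n)\<close> has Hankel form \<open>L((\<Sum> c i Q i)\<^sup>2)\<close>. If the variance \<open>b\<close> is 0, the equation
  determines no \<open>T\<close>; the default is then the moment series 1 of the point mass at 0.
\<close>

lemma positive_moments_obtain_first_return:
  assumes S: "positive_moments S"
  obtains a b T where "b \<ge> 0" "positive_moments T"
    "S * (1 - fps_const a * fps_X - fps_const b * fps_X\<^sup>2 * T) = 1"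
    "b = 0 \<Longrightarrow> T = 1" "a = S $ 1" "b = S $ 2 - (S $ 1)\<^sup>2"
proof -
  let ?L = "moment_functional S" and ?x = "monom 1 1 :: real poly"
  define a where "a = S $ 1"
  define Q :: "nat \<Rightarrow> real poly" where
    "Q = rec_nat (?x - [:a:]) (\<lambda>_ q. ?x * q - [:?L (?x * q):])"
  have Q_0: "Q 0 = ?x - [:a:]" and Q_Suc: "Q (Suc n) = ?x * Q n - [:?L (?x * Q n):]" for n
    by (simp_all add: Q_def)
  have S0: "S $ 0 = 1" using S by (rule positive_moments_0)
  have L_Q: "?L (Q n) = 0" for n
    by (cases n) (simp_all add: Q_0 Q_Suc moment_functional_linear moment_functional_const S0 a_def)
  have step: "?L (Q (Suc i) * p) = ?L (?x * (Q i * p)) - ?L (?x * Q i) * ?L p" for i p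
    by (simp add: Q_Suc moment_functional_linear algebra_simps)
  have shift: "?L (Q (Suc i) * Q j) = ?L (Q i * Q (Suc j))" for i j
    using step[of i "Q j"] step[of j "Q i"] by (simp add: L_Q mult_ac)
  have Q_mult: "?L (Q i * Q j) = ?L (Q 0 * Q (i + j))" for i j
    by (induction i arbitrary: j) (simp_all add: shift)
  have x_Q: "?L (?x * Q n) = ?L (Q 0 * Q n)" for n
    by (simp add: Q_0 moment_functional_linear algebra_simps L_Q)
  define b where "b = ?L (Q 0 * Q 0)"
  have "b \<ge> 0" unfolding b_def by (rule positive_moments_square[OF S])
  have "Q 0 * Q 0 = ?x * ?x - smult a ?x - smult a ?x + [:a * a:]"
    by (simp add: Q_0 algebra_simps)
  hence b_eq: "b = S $ 2 - (S $ 1)\<^sup>2"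
    by (simp add: b_def moment_functional_linear moment_functional_numeral_mult mult_monom moment_functional_const S0 a_def
        power2_eq_square numeral_2_eq_2)
  define T where "T = (if b = 0 then 1 else Abs_fps (\<lambda>n. ?L (Q 0 * Q n) / b))"
  have bT: "b * T $ n = ?L (Q 0 * Q n)" for n
  proof (cases "b = 0")
    case True
    thus ?thesis using moment_functional_null_square[OF S, of "Q 0"] by (simp add: b_def)
  qed (simp add: T_def)
  have Q_Q: "?L (Q i * Q j) = b * T $ (i + j)" for i j
    using Q_mult[of i j] bT[of "i + j"] by simp
  have x_pow: "?L (monom 1 n * Q k) = (\<Sum>j<n. S $ (n - Suc j) * (b * T $ (k + j)))" for n k
  proof (induction n arbitrary: k)
    case 0
    show ?case by (simp add: L_Q monom_0 flip: one_pCons)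
  next
    case (Suc n)
    have m: "monom 1 (Suc n) * Q k = ?x * (Q k * monom 1 n)"
      by (simp add: mult.left_commute[of "?x"] mult_monom mult.commute[of "Q k"] flip: mult.assoc)
    have "?L (monom 1 (Suc n) * Q k) = ?L (monom 1 n * Q (Suc k)) + S $ n * (b * T $ k)"
    proof -
      have "?L (Q (Suc k) * monom 1 n) = ?L (?x * (Q k * monom 1 n)) - b * T $ k * S $ n"
        using step[of k "monom 1 n"] unfolding x_Q bT by simp
      thus ?thesis unfolding m by (simp add: mult.commute[of "monom 1 n" "Q (Suc k)"])
    qed
    thus ?case unfolding Suc by (subst sum.lessThan_Suc_shift) simp
  qed
  have "S $ Suc n = a * S $ n + b * (\<Sum>k<n. S $ (n - Suc k) * T $ k)" for n
  proof -
    have "?L (monom 1 n * Q 0) = S $ Suc n - a * S $ n"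
      by (simp add: Q_0 algebra_simps mult_monom moment_functional_linear)
    thus ?thesis using x_pow[of n 0] by (simp add: sum_distrib_left mult_ac)
  qed
  hence rec: "S * (1 - fps_const a * fps_X - fps_const b * fps_X\<^sup>2 * T) = 1"
    by (simp add: first_return_recursion S0)
  have "positive_moments T"
  proof (cases "b = 0")
    case True
    thus ?thesis by (simp add: T_def positive_moments_1)
  next
    case False
    show ?thesis
    proof (rule positive_momentsI)
      show "T $ 0 = 1" using bT[of 0] False by (simp add: b_def)
      fix c :: "nat \<Rightarrow> real" and n
      let ?R = "\<Sum>i\<le>n. smult (c i) (Q i)"
      have "?L (?R * ?R) = (\<Sum>i\<le>n. \<Sum>j\<le>n. ?L (smult (c i) (Q i) * smult (c j) (Q j)))"
        by (simp only: sum_product moment_functional_sum)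
      also have "\<dots> = (\<Sum>i\<le>n. \<Sum>j\<le>n. c i * c j * ?L (Q i * Q j))"
        by (intro sum.cong refl) (simp add: moment_functional_smult)
      also have "\<dots> = b * (\<Sum>i\<le>n. \<Sum>j\<le>n. c i * c j * T $ (i + j))"
        by (simp only: Q_Q sum_distrib_left mult_ac)
      finally show "0 \<le> (\<Sum>i\<le>n. \<Sum>j\<le>n. c i * c j * T $ (i + j))"
        using positive_moments_square[OF S, of ?R] False \<open>b \<ge> 0\<close> by (simp add: zero_le_mult_iff)
    qed
  qed
  thus ?thesis
    by (intro that[of b T a]) (use \<open>b \<ge> 0\<close> rec b_eq in \<open>auto simp: T_def a_def\<close>)
qed

section \<open>Radius of convergence of moment and cumulant series\<close>

lemma fps_conv_radius_pos_iff:
  fixes f :: "real fps"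
  shows "fps_conv_radius f > 0 \<longleftrightarrow> (\<exists>K B. K \<ge> 1 \<and> B > 0 \<and> (\<forall>n. \<bar>f $ n\<bar> \<le> K * B ^ n))"
proof
  assume "fps_conv_radius f > 0"
  then obtain r where r: "0 < ereal r" "ereal r < fps_conv_radius f"
    using ereal_dense2 by blast
  hence "r > 0" by simp
  have "summable (\<lambda>n. norm (f $ n * r ^ n))"
    by (rule norm_summable_fps) (use r \<open>r > 0\<close> in auto)
  hence "bounded (range (\<lambda>n. norm (f $ n * r ^ n)))"
    by (intro summable_imp_bounded)
  then obtain K where K: "\<And>n. norm (f $ n * r ^ n) \<le> K"
    by (auto simp: bounded_iff)
  have "\<bar>f $ n\<bar> \<le> max 1 K * (1 / r) ^ n" for n
    using K[of n] \<open>r > 0\<close> by (auto simp: abs_mult power_one_over field_simps)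
  thus "\<exists>K B. K \<ge> 1 \<and> B > 0 \<and> (\<forall>n. \<bar>f $ n\<bar> \<le> K * B ^ n)"
    using \<open>r > 0\<close> by (intro exI[of _ "max 1 K"] exI[of _ "1 / r"]) auto
next
  assume "\<exists>K B. K \<ge> 1 \<and> B > 0 \<and> (\<forall>n. \<bar>f $ n\<bar> \<le> K * B ^ n)"
  then obtain K B where KB: "B > 0" "\<And>n. \<bar>f $ n\<bar> \<le> K * B ^ n" by blast
  define r where "r = 1 / (2 * B)"
  have "r > 0" using KB by (simp add: r_def)
  have "summable (\<lambda>n. f $ n * of_real r ^ n)"
  proof (rule summable_comparison_test)
    show "\<exists>N. \<forall>n\<ge>N. norm (f $ n * of_real r ^ n) \<le> K * (1 / 2) ^ n"
    proof (intro exI[of _ 0] allI impI)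
      fix n
      have "\<bar>f $ n\<bar> * r ^ n \<le> K * B ^ n * r ^ n"
        using KB \<open>r > 0\<close> by (intro mult_right_mono) auto
      also have "\<dots> = K * (B * r) ^ n" by (simp add: power_mult_distrib)
      also have "B * r = 1 / 2" using KB by (simp add: r_def)
      finally show "norm (f $ n * of_real r ^ n) \<le> K * (1 / 2) ^ n"
        using \<open>r > 0\<close> by (simp add: abs_mult)
    qed
    show "summable (\<lambda>n. K * (1 / 2 :: real) ^ n)" by (intro summable_mult summable_geometric) simp
  qed
  hence "ereal (norm (of_real r :: real)) \<le> fps_conv_radius f"
    unfolding fps_conv_radius_def by (intro conv_radius_geI) simp
  moreover have "0 < ereal (norm (of_real r :: real))" using \<open>r > 0\<close> by simp
  ultimately show "fps_conv_radius f > 0" by (rule less_le_trans[rotated])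
qed

lemma fps_conv_radius_add_pos:
  "fps_conv_radius f > 0 \<Longrightarrow> fps_conv_radius g > 0 \<Longrightarrow> fps_conv_radius (f + g) > 0"
  by (rule less_le_trans[OF _ fps_conv_radius_add]) simp

lemma fps_conv_radius_diff_pos:
  "fps_conv_radius f > 0 \<Longrightarrow> fps_conv_radius g > 0 \<Longrightarrow> fps_conv_radius (f - g) > 0"
  by (rule less_le_trans[OF _ fps_conv_radius_diff]) simp

lemma fps_conv_radius_mult_pos:
  "fps_conv_radius f > 0 \<Longrightarrow> fps_conv_radius g > 0 \<Longrightarrow> fps_conv_radius (f * g) > 0"
  by (rule less_le_trans[OF _ fps_conv_radius_mult]) simp

lemma fps_conv_radius_dilation_pos:
  fixes f :: "real fps"
  assumes "fps_conv_radius f > 0"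
  shows "fps_conv_radius (f oo (fps_const c * fps_X)) > 0"
proof -
  obtain K B where KB: "K \<ge> 1" "B > 0" "\<And>n. \<bar>f $ n\<bar> \<le> K * B ^ n"
    using assms unfolding fps_conv_radius_pos_iff by blast
  have "\<bar>c ^ n * f $ n\<bar> \<le> K * ((\<bar>c\<bar> + 1) * B) ^ n" for n
  proof -
    have "\<bar>c ^ n * f $ n\<bar> \<le> (\<bar>c\<bar> + 1) ^ n * (K * B ^ n)"
      unfolding abs_mult power_abs by (intro mult_mono power_mono KB) auto
    thus ?thesis by (simp add: power_mult_distrib mult_ac)
  qed
  moreover have "(\<bar>c\<bar> + 1) * B > 0" using KB by (intro mult_pos_pos) auto
  ultimately show ?thesis
    unfolding fps_conv_radius_pos_iff fps_compose_linear fps_nth_Abs_fps using KB(1) by blast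
qed

text \<open>
  The partial sums of the norm \<open>\<Sum> \<bar>f $ n\<bar> r\<^sup>n\<close> are submultiplicative as well; unlike the norm itself, they
  are available before convergence is known.
\<close>

lemma fps_weighted_norm_mult:
  fixes f g :: "real fps"
  assumes "r \<ge> 0"
  shows "(\<Sum>n\<le>N. \<bar>(f * g) $ n\<bar> * r ^ n) \<le> (\<Sum>n\<le>N. \<bar>f $ n\<bar> * r ^ n) * (\<Sum>n\<le>N. \<bar>g $ n\<bar> * r ^ n)"
proof -
  let ?a = "\<lambda>i j. (\<bar>f $ i\<bar> * r ^ i) * (\<bar>g $ j\<bar> * r ^ j)"
  have "(\<Sum>n\<le>N. \<bar>(f * g) $ n\<bar> * r ^ n) \<le> (\<Sum>n\<le>N. \<Sum>i\<le>n. ?a i (n - i))"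
  proof (intro sum_mono)
    fix n
    have "\<bar>(f * g) $ n\<bar> * r ^ n \<le> (\<Sum>i\<le>n. \<bar>f $ i * g $ (n - i)\<bar>) * r ^ n"
      unfolding fps_mult_nth atLeast0AtMost
      by (intro mult_right_mono sum_abs) (use assms in auto)
    also have "\<dots> = (\<Sum>i\<le>n. ?a i (n - i))"
      unfolding sum_distrib_right
    proof (intro sum.cong refl)
      fix i assume "i \<in> {..n}"
      hence "r ^ n = r ^ i * r ^ (n - i)" by (simp flip: power_add)
      thus "\<bar>f $ i * g $ (n - i)\<bar> * r ^ n = ?a i (n - i)" by (simp add: abs_mult)
    qed
    finally show "\<bar>(f * g) $ n\<bar> * r ^ n \<le> (\<Sum>i\<le>n. ?a i (n - i))" .
  qed
  also have "\<dots> = (\<Sum>(n, i)\<in>(SIGMA n:{..N}. {..n}). ?a i (n - i))"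
    by (subst sum.Sigma) auto
  also have "\<dots> = (\<Sum>(i, j)\<in>{(i, j). i + j \<le> N}. ?a i j)"
    by (rule sum.reindex_bij_witness[of _ "\<lambda>(i, j). (i + j, i)" "\<lambda>(n, i). (i, n - i)"]) auto
  also have "\<dots> \<le> (\<Sum>(i, j)\<in>{..N} \<times> {..N}. ?a i j)"
    by (rule sum_mono2) (use assms in auto)
  also have "\<dots> = (\<Sum>n\<le>N. \<bar>f $ n\<bar> * r ^ n) * (\<Sum>n\<le>N. \<bar>g $ n\<bar> * r ^ n)"
    by (simp add: sum_product sum.cartesian_product)
  finally show ?thesis .
qed

lemma fps_weighted_norm_power:
  fixes f :: "real fps"
  assumes "r \<ge> 0"
  shows "(\<Sum>n\<le>N. \<bar>(f ^ k) $ n\<bar> * r ^ n) \<le> (\<Sum>n\<le>N. \<bar>f $ n\<bar> * r ^ n) ^ k"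
proof (induction k)
  case 0
  have "(\<Sum>n\<le>N. \<bar>(f ^ 0) $ n\<bar> * r ^ n) = (\<Sum>n\<le>N. if n = 0 then 1 else 0)"
    by (intro sum.cong) auto
  thus ?case by simp
next
  case (Suc k)
  have "(\<Sum>n\<le>N. \<bar>f $ n\<bar> * r ^ n) \<ge> 0" by (intro sum_nonneg) (use assms in auto)
  thus ?case
    using fps_weighted_norm_mult[OF assms, of f "f ^ k" N] mult_left_mono[OF Suc] by force
qed

text \<open>
  Write \<open>\<bar>C $ k\<bar> \<le> K B\<^sup>k\<close>. If the partial norm of \<open>M\<close> of order \<open>N\<close> is at most \<open>2 K\<close>, then that of \<open>z M\<close> of
  order \<open>N + 1\<close> is at most \<open>2 K r\<close>, and \<open>C(z M) = M\<close> bounds the partial norm of \<open>M\<close> of order \<open>N + 1\<close> by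
  \<open>K \<Sum> (2 K B r)\<^sup>k\<close>. For \<open>r = 1 / (4 B K)\<close> this is again at most \<open>2 K\<close>, so the bound propagates.
\<close>

lemma fps_conv_radius_free_moments:
  fixes C M :: "real fps"
  assumes C: "fps_conv_radius C > 0" and eq: "C oo (fps_X * M) = M"
  shows "fps_conv_radius M > 0"
proof -
  obtain K B where KB: "K \<ge> 1" "B > 0" "\<And>n. \<bar>C $ n\<bar> \<le> K * B ^ n"
    using C unfolding fps_conv_radius_pos_iff by blast
  define r where "r = 1 / (4 * B * K)"
  have "r > 0" using KB by (simp add: r_def)
  define S where "S f N = (\<Sum>n\<le>N. \<bar>f $ n\<bar> * r ^ n)" for f :: "real fps" and N
  let ?A = "fps_X * M"
  have bound: "S M N \<le> 2 * K" for N
  proof (induction N)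
    case 0
    have "M $ 0 = C $ 0" using arg_cong[OF eq, of "\<lambda>f. f $ 0"] by simp
    thus ?case using KB(1) KB(3)[of 0] by (simp add: S_def)
  next
    case (Suc N)
    have S_A: "S ?A (Suc N) = r * S M N"
    proof -
      have "S ?A (Suc N) = (\<Sum>n\<le>N. \<bar>?A $ Suc n\<bar> * r ^ Suc n)"
        unfolding S_def by (subst sum.atMost_Suc_shift) simp
      thus ?thesis by (simp add: S_def sum_distrib_left mult_ac)
    qed
    have S_nonneg: "S f N \<ge> 0" for f N
      unfolding S_def by (intro sum_nonneg) (use \<open>r > 0\<close> in auto)
    have "S M (Suc N) \<le> (\<Sum>n\<le>Suc N. \<Sum>k\<le>Suc N. \<bar>C $ k\<bar> * (\<bar>(?A ^ k) $ n\<bar> * r ^ n))"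
      unfolding S_def
    proof (intro sum_mono)
      fix n assume n: "n \<in> {..Suc N}"
      have "\<bar>M $ n\<bar> \<le> (\<Sum>k=0..n. \<bar>C $ k * (?A ^ k) $ n\<bar>)"
        by (subst eq[symmetric], subst fps_compose_nth) (rule sum_abs)
      also have "\<dots> \<le> (\<Sum>k\<le>Suc N. \<bar>C $ k * (?A ^ k) $ n\<bar>)"
        by (rule sum_mono2) (use n in auto)
      finally have "\<bar>M $ n\<bar> * r ^ n \<le> (\<Sum>k\<le>Suc N. \<bar>C $ k * (?A ^ k) $ n\<bar>) * r ^ n"
        by (rule mult_right_mono) (use \<open>r > 0\<close> in auto)
      thus "\<bar>M $ n\<bar> * r ^ n \<le> (\<Sum>k\<le>Suc N. \<bar>C $ k\<bar> * (\<bar>(?A ^ k) $ n\<bar> * r ^ n))"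
        by (simp only: sum_distrib_right abs_mult mult.assoc)
    qed
    also have "\<dots> = (\<Sum>k\<le>Suc N. \<bar>C $ k\<bar> * S (?A ^ k) (Suc N))"
      by (subst sum.swap) (simp only: S_def sum_distrib_left)
    also have "\<dots> \<le> (\<Sum>k\<le>Suc N. K * (1 / 2) ^ k)"
    proof (intro sum_mono)
      fix k
      have "S (?A ^ k) (Suc N) \<le> S ?A (Suc N) ^ k"
        unfolding S_def by (rule fps_weighted_norm_power) (use \<open>r > 0\<close> in auto)
      also have "\<dots> \<le> (r * (2 * K)) ^ k"
        unfolding S_A using Suc \<open>r > 0\<close> S_nonneg[of M N] by (intro power_mono mult_left_mono) auto
      finally have "\<bar>C $ k\<bar> * S (?A ^ k) (Suc N) \<le> (K * B ^ k) * (r * (2 * K)) ^ k"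
        using KB S_nonneg by (intro mult_mono) auto
      also have "\<dots> = K * (B * (r * (2 * K))) ^ k" by (simp add: power_mult_distrib)
      also have "B * (r * (2 * K)) = 1 / 2" using KB by (simp add: r_def field_simps)
      finally show "\<bar>C $ k\<bar> * S (?A ^ k) (Suc N) \<le> K * (1 / 2) ^ k" .
    qed
    also have "\<dots> = K * (\<Sum>k\<le>Suc N. (1 / 2) ^ k)" by (simp only: sum_distrib_left)
    also have "(\<Sum>k\<le>Suc N. (1 / 2) ^ k) \<le> (2 :: real)"
    proof -
      have "(\<Sum>k\<le>n. (1 / 2) ^ k) = 2 - (1 / 2 :: real) ^ n" for n
        by (induction n) (simp_all add: field_simps)
      thus ?thesis by simp
    qed
    finally show ?case using KB(1) by (simp add: mult.commute)
  qed
  have "\<bar>M $ n\<bar> \<le> 2 * K * (1 / r) ^ n" for n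
  proof -
    have "\<bar>M $ n\<bar> * r ^ n \<le> S M n"
      unfolding S_def by (rule member_le_sum) (use \<open>r > 0\<close> in auto)
    hence "\<bar>M $ n\<bar> * r ^ n \<le> 2 * K" using bound[of n] by linarith
    thus ?thesis using \<open>r > 0\<close> by (simp add: power_one_over field_simps)
  qed
  thus ?thesis
    unfolding fps_conv_radius_pos_iff using KB(1) \<open>r > 0\<close>
    by (intro exI[of _ "2 * K"] exI[of _ "1 / r"]) auto
qed

section \<open>Free cumulants and subordination as identities of formal power series\<close>

text \<open>
  The functional equation says that \<open>z M(z)\<close> is inverse to \<open>m / C(m)\<close> under composition.
\<close>

lemma free_moments_iff_inverse:
  fixes C M :: "real fps"
  assumes "C $ 0 \<noteq> 0"
  shows "C oo (fps_X * M) = M \<longleftrightarrow> (fps_X * inverse C) oo (fps_X * M) = fps_X"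
proof -
  have "(fps_X * inverse C) oo (fps_X * M) = fps_X * M * inverse (C oo (fps_X * M))"
    using assms by (simp add: fps_compose_mult_distrib fps_inverse_compose)
  also have "\<dots> = fps_X \<longleftrightarrow> C oo (fps_X * M) = M"
  proof
    assume *: "C oo (fps_X * M) = M"
    have "M $ 0 \<noteq> 0" using arg_cong[OF *, of "\<lambda>f. f $ 0"] assms by simp
    thus "fps_X * M * inverse (C oo (fps_X * M)) = fps_X"
      unfolding * by (simp add: mult.assoc inverse_mult_eq_1')
  next
    assume "fps_X * M * inverse (C oo (fps_X * M)) = fps_X"
    hence "fps_X * M * (inverse (C oo (fps_X * M)) * (C oo (fps_X * M))) = fps_X * (C oo (fps_X * M))"
      by (simp add: mult.assoc[symmetric])
    also have "inverse (C oo (fps_X * M)) * (C oo (fps_X * M)) = 1"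
      by (rule inverse_mult_eq_1) (use assms in simp)
    finally show "C oo (fps_X * M) = M" by simp
  qed
  finally show ?thesis by blast
qed

lemma fps_compose_inverse_sym:
  fixes f g :: "real fps"
  assumes "f oo g = fps_X" "g $ 0 = 0" "g $ 1 \<noteq> 0"
  shows "g oo f = fps_X"
proof -
  have "f oo g = fps_inv g oo g" using assms by (simp add: fps_inv)
  hence "f = fps_inv g" using assms fps_compose_inj_right by blast
  thus ?thesis using fps_inv_right[of g] assms by simp
qed

lemma free_moments_exist:
  fixes C :: "real fps"
  assumes "C $ 0 \<noteq> 0"
  obtains M where "C oo (fps_X * M) = M"
proof -
  let ?W = "fps_X * inverse C"
  define M where "M = fps_shift 1 (fps_inv ?W)"
  have "fps_inv ?W $ 0 = 0" by (simp add: fps_inv_def)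
  hence "fps_X * M = fps_inv ?W"
    by (intro fps_ext) (auto simp: M_def)
  hence "?W oo (fps_X * M) = fps_X"
    using assms by (simp add: fps_inv_right)
  thus ?thesis using that free_moments_iff_inverse[OF assms] by blast
qed

text \<open>
  If \<open>R\<close> is the moment series of \<open>\<rho>\<close>, this is \<open>\<integral> 1 / (D - x z) d\<rho>(x)\<close>. Multiplied by \<open>z\<close>,
  it is the Cauchy transform of \<open>\<rho>\<close> at \<open>D(z) / z\<close>.
\<close>

definition mixed_resolvent :: "real fps \<Rightarrow> real fps \<Rightarrow> real fps" where
  "mixed_resolvent R D = inverse D * (R oo (fps_X * inverse D))"

text \<open>
  Here \<open>M\<close> is a law with cumulant series \<open>C\<close>, one continued fraction step reduces \<open>M\<close> to \<open>R\<close>, and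
  \<open>M'\<close> is any other series, such as the moment series of a free convolution. The series
  \<open>U = z / D\<close> solves \<open>U M(U) = z M'\<close>, so \<open>D(z) / z\<close>, read in the variable \<open>1 / z\<close>, is the
  subordination function of \<open>M'\<close> with respect to \<open>M\<close>.
  The second claim is subordination itself. The first one inserts \<open>U\<close> into the continued fraction of
  \<open>M\<close>; it is used to express \<open>D\<close> through \<open>mixed_resolvent R D\<close>.
\<close>

lemma subordination_step:
  fixes C M R M' :: "real fps"
  assumes C: "C oo (fps_X * M) = M" and M0: "M $ 0 = 1"
    and R: "M * (1 - fps_const a * fps_X - fps_const b * fps_X\<^sup>2 * R) = 1"
    and M'0: "M' $ 0 = 1"
  defines "D \<equiv> (C oo (fps_X * M')) * inverse M'"
  shows "D - fps_const a * fps_X - fps_const b * fps_X\<^sup>2 * mixed_resolvent R D = inverse M'"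
    and "mixed_resolvent M D = M'"
proof -
  let ?P = "C oo (fps_X * M')" and ?U = "fps_X * inverse D" and ?W = "fps_X * inverse C"
  have C0: "C $ 0 = 1" by (metis C M0 fps_compose_nth_0)
  have P0: "?P $ 0 = 1" by (simp add: C0)
  have D0: "D $ 0 = 1" by (simp add: D_def C0 M'0)
  have M': "M' * inverse M' = 1" by (rule inverse_mult_eq_1') (simp add: M'0)
  have D: "D * inverse D = 1" by (rule inverse_mult_eq_1') (simp add: D0)
  have "M' * D = (M' * inverse M') * ?P" by (simp add: D_def mult_ac)
  hence DM': "M' * D = ?P" by (simp add: M')
  have "?U = fps_X * M' * inverse ?P"
  proof -
    have "inverse D = inverse ?P * M'"
      unfolding D_def by (simp add: fps_inverse_mult fps_inverse_idempotent M'0)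
    thus ?thesis by (simp add: mult_ac)
  qed
  also have "\<dots> = ?W oo (fps_X * M')"
    by (simp add: fps_compose_mult_distrib fps_inverse_compose C0)
  finally have U: "?U = ?W oo (fps_X * M')" .
  have "?W oo (fps_X * M) = fps_X"
    using C C0 free_moments_iff_inverse[of C M] by simp
  hence "(fps_X * M) oo ?W = fps_X"
    by (rule fps_compose_inverse_sym) (simp_all add: M0)
  hence "(fps_X * M) oo ?U = fps_X * M'"
    unfolding U by (subst fps_compose_assoc) simp_all
  hence "?U * (M oo ?U) = fps_X * M'"
    by (simp add: fps_compose_mult_distrib)
  hence MU: "inverse D * (M oo ?U) = M'"
    by (simp add: mult.assoc)
  thus "mixed_resolvent M D = M'" by (simp add: mixed_resolvent_def)
  have "M oo ?U = ?P"
    using arg_cong[OF MU, of "\<lambda>f. D * f"] D DM' by (simp add: mult.assoc[symmetric] mult.commute)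
  moreover have "(M oo ?U) * (1 - fps_const a * ?U - fps_const b * ?U\<^sup>2 * (R oo ?U)) = 1"
    using arg_cong[OF R, of "\<lambda>f. f oo ?U"]
    by (simp add: fps_compose_mult_distrib fps_compose_sub_distrib power2_eq_square)
  ultimately have PU: "?P * (1 - fps_const a * ?U - fps_const b * ?U\<^sup>2 * (R oo ?U)) = 1" by simp
  have "inverse M' = inverse M' * (?P * (1 - fps_const a * ?U - fps_const b * ?U\<^sup>2 * (R oo ?U)))"
    by (simp add: PU)
  also have "\<dots> = D * (1 - fps_const a * ?U - fps_const b * ?U\<^sup>2 * (R oo ?U))"
    by (simp add: D_def mult_ac)
  also have "\<dots> = D - fps_const a * fps_X * (D * inverse D)
      - fps_const b * fps_X\<^sup>2 * (D * inverse D) * (inverse D * (R oo ?U))"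
    by (simp add: algebra_simps power2_eq_square)
  finally show "D - fps_const a * fps_X - fps_const b * fps_X\<^sup>2 * mixed_resolvent R D = inverse M'"
    by (simp add: D mixed_resolvent_def)
qed

lemma fps_agree_mult:
  fixes f g f' g' :: "real fps"
  assumes "\<forall>i<n. f $ i = f' $ i" "\<forall>i<n. g $ i = g' $ i"
  shows "\<forall>i<n. (f * g) $ i = (f' * g') $ i"
  using assms by (auto simp: fps_mult_nth intro!: sum.cong)

lemma fps_agree_inverse:
  fixes f f' :: "real fps"
  assumes "\<forall>i<n. f $ i = f' $ i" "f $ 0 \<noteq> 0" "f' $ 0 \<noteq> 0"
  shows "\<forall>i<n. inverse f $ i = inverse f' $ i"
proof -
  have "inverse f' - inverse f = (f - f') * (inverse f * inverse f')"
    using inverse_mult_eq_1'[OF assms(2)] inverse_mult_eq_1'[OF assms(3)]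
    by (simp add: algebra_simps)
  moreover have "\<forall>i<n. ((f - f') * (inverse f * inverse f')) $ i = (0 * (inverse f * inverse f')) $ i"
    by (rule fps_agree_mult) (use assms in auto)
  ultimately have "\<forall>i<n. (inverse f' - inverse f) $ i = 0" by simp
  thus ?thesis by simp
qed

lemma fps_agree_compose:
  fixes f g g' :: "real fps"
  assumes "\<forall>i<n. g $ i = g' $ i"
  shows "\<forall>i<n. (f oo g) $ i = (f oo g') $ i"
proof -
  have "\<forall>i<n. (g ^ k) $ i = (g' ^ k) $ i" for k
  proof (induction k)
    case (Suc k)
    show ?case unfolding power_Suc by (rule fps_agree_mult[OF assms Suc])
  qed simp
  thus ?thesis by (simp add: fps_compose_nth)
qed

lemma fps_agree_mixed_resolvent:
  assumes "\<forall>i<n. D $ i = D' $ i" "D $ 0 \<noteq> 0" "D' $ 0 \<noteq> 0"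
  shows "\<forall>i<n. mixed_resolvent R D $ i = mixed_resolvent R D' $ i"
  unfolding mixed_resolvent_def
  by (intro fps_agree_mult fps_agree_compose fps_agree_inverse assms) simp_all

section \<open>The moment problem with geometric bounds\<close>

definition moment_measure :: "real measure \<Rightarrow> real fps \<Rightarrow> bool" where
  "moment_measure \<mu> M \<longleftrightarrow> real_distribution \<mu> \<and> (\<exists>B>0. AE x in \<mu>. \<bar>x\<bar> \<le> B) \<and>
     (\<forall>n. (\<integral>x. x ^ n \<partial>\<mu>) = M $ n)"

lemma moment_measure_integrable_power:
  assumes "moment_measure \<mu> M"
  shows "integrable \<mu> (\<lambda>x. x ^ n)"
proof -
  interpret real_distribution \<mu> using assms by (simp add: moment_measure_def)
  obtain B where B: "B > 0" "AE x in \<mu>. \<bar>x\<bar> \<le> B" using assms by (auto simp: moment_measure_def)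
  show ?thesis
  proof (rule integrable_const_bound)
    show "AE x in \<mu>. norm (x ^ n) \<le> B ^ n"
      using B(2) by eventually_elim (auto simp: power_abs intro: power_mono)
  qed simp
qed

lemma moment_functional_eq_integral:
  assumes "moment_measure \<mu> M"
  shows "moment_functional M p = (\<integral>x. poly p x \<partial>\<mu>)"
proof -
  have "(\<integral>x. poly p x \<partial>\<mu>) = (\<Sum>i\<le>degree p. coeff p i * (\<integral>x. x ^ i \<partial>\<mu>))"
    unfolding poly_altdef
    by (subst Bochner_Integration.integral_sum)
       (auto intro: integrable_mult_right moment_measure_integrable_power[OF assms])
  thus ?thesis using assms by (simp add: moment_functional_def moment_measure_def)
qed

lemma moment_measure_imp_positive_moments:
  assumes "moment_measure \<mu> M"
  shows "positive_moments M"
proof -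
  interpret real_distribution \<mu> using assms by (simp add: moment_measure_def)
  have "(\<integral>x. x ^ 0 \<partial>\<mu>) = M $ 0" using assms unfolding moment_measure_def by blast
  hence "M $ 0 = 1" using prob_space by simp
  thus ?thesis
    by (simp add: positive_moments_def moment_functional_eq_integral[OF assms])
qed

text \<open>
  A polynomial with a square root among power series of radius larger than the growth rate of the
  moments is a limit of squares of polynomials, in a norm for which the functional is continuous. The
  squares of the truncations of \<open>f\<close> agree with \<open>P\<close> below order \<open>N\<close>, and the remaining coefficients, at
  most \<open>N + 1\<close> of them, contribute \<open>O(N (1/2)\<^sup>N)\<close> each.
\<close>

lemma moment_functional_fps_square_nonneg:
  fixes f :: "real fps"
  assumes M: "positive_moments M" and M_bound: "\<And>n. \<bar>M $ n\<bar> \<le> K * (1 / 4) ^ n"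
    and f_bound: "\<And>n. \<bar>f $ n\<bar> \<le> A * 2 ^ n" and P: "f * f = fps_of_poly P"
  shows "0 \<le> moment_functional M P"
proof -
  have "K \<ge> 0" using M_bound[of 0] by simp
  have "A \<ge> 0" using f_bound[of 0] by simp
  define err where "err N = (real N + 1) * (2 * real N + 1) * (1 / 2) ^ N * (A * A * K)" for N :: nat
  have "- err N \<le> moment_functional M P" if N: "N > degree P" for N
  proof -
    define p where "p = truncate_fps N f"
    have coeff_p: "\<bar>coeff p i\<bar> \<le> A * 2 ^ i" for i
      using f_bound[of i] \<open>A \<ge> 0\<close> by (simp add: p_def coeff_truncate_fps)
    have low: "coeff (p * p) n = coeff P n" if "n < N" for n
    proof -
      have "\<forall>i<N. (fps_of_poly p * fps_of_poly p) $ i = (f * f) $ i"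
        by (rule fps_agree_mult) (simp_all add: p_def)
      thus ?thesis using that by (simp add: P fps_of_poly_mult[symmetric])
    qed
    have high: "\<bar>coeff (p * p) n * M $ n\<bar> \<le> (2 * real N + 1) * (1 / 2) ^ N * (A * A * K)"
      if n: "n \<in> {N..2 * N}" for n
    proof -
      have "\<bar>coeff (p * p) n\<bar> \<le> (\<Sum>i\<le>n. \<bar>coeff p i * coeff p (n - i)\<bar>)"
        unfolding coeff_mult by (rule sum_abs)
      also have "\<dots> \<le> (\<Sum>i\<le>n. A * A * 2 ^ n)"
      proof (rule sum_mono)
        fix i assume "i \<in> {..n}"
        hence "A * A * 2 ^ n = (A * 2 ^ i) * (A * 2 ^ (n - i))"
          by (simp flip: power_add)
        thus "\<bar>coeff p i * coeff p (n - i)\<bar> \<le> A * A * 2 ^ n"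
          unfolding abs_mult using coeff_p \<open>A \<ge> 0\<close> by (simp only:) (intro mult_mono; simp)
      qed
      finally have "\<bar>coeff (p * p) n\<bar> \<le> (real n + 1) * (A * A * 2 ^ n)" by (simp add: algebra_simps)
      hence "\<bar>coeff (p * p) n * M $ n\<bar> \<le> (real n + 1) * (A * A * 2 ^ n) * (K * (1 / 4) ^ n)"
        unfolding abs_mult using M_bound \<open>A \<ge> 0\<close> by (intro mult_mono) auto
      also have "\<dots> = (real n + 1) * (2 * (1 / 4)) ^ n * (A * A * K)"
        by (simp only: power_mult_distrib mult_ac)
      also have "\<dots> \<le> (2 * real N + 1) * (1 / 2) ^ N * (A * A * K)"
        using n \<open>A \<ge> 0\<close> \<open>K \<ge> 0\<close> by (intro mult_mono) (auto intro: power_decreasing)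
      finally show ?thesis .
    qed
    have deg: "degree (p * p) \<le> 2 * N"
    proof -
      have "degree p \<le> N" using degree_truncate_fps[of N f] N by (simp add: p_def)
      thus ?thesis using degree_mult_le[of p p] by simp
    qed
    have "{..2 * N} = {..<N} \<union> {N..2 * N}" by auto
    hence "moment_functional M (p * p) = (\<Sum>n<N. coeff (p * p) n * M $ n) + (\<Sum>n=N..2*N. coeff (p * p) n * M $ n)"
      by (simp add: moment_functional_altdef[OF deg] sum.union_disjoint disjoint_iff)
    also have "(\<Sum>n<N. coeff (p * p) n * M $ n) = (\<Sum>n\<le>N. coeff P n * M $ n)"
      using low N by (simp add: lessThan_Suc_atMost[symmetric] coeff_eq_0)
    also have "\<dots> = moment_functional M P"
      using N by (simp add: moment_functional_altdef[of P N])
    also have "(\<Sum>n=N..2*N. coeff (p * p) n * M $ n) \<le> (\<Sum>n=N..2*N. (2 * real N + 1) * (1 / 2) ^ N * (A * A * K))"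
      using high by (intro sum_mono) force
    also have "\<dots> = err N" by (simp add: err_def)
    finally show ?thesis using positive_moments_square[OF M, of p] by simp
  qed
  moreover have "err \<longlonglongrightarrow> 0"
  proof -
    have "(\<lambda>N. (real N + 1) * (2 * real N + 1) * (1 / 2) ^ N) \<longlonglongrightarrow> 0" by real_asymp
    thus ?thesis unfolding err_def by (rule tendsto_mult_left_zero)
  qed
  hence "(\<lambda>N. - err N) \<longlonglongrightarrow> 0" using tendsto_minus by fastforce
  ultimately show ?thesis
    by (intro LIMSEQ_le_const2[of "\<lambda>N. - err N"]) (auto intro!: exI[of _ "Suc (degree P)"])
qed

text \<open>
  Both \<open>(1 + X)\<^sup>k\<close> and \<open>(1 - X)\<^sup>l\<close> have binomial series as square roots, with radius of convergence at
  least 1. In this way positivity on squares becomes positivity on the Bernstein polynomials of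
  \<open>[-1, 1]\<close>.
\<close>

lemma moment_functional_product_nonneg:
  assumes M: "positive_moments M" and M_bound: "\<And>n. \<bar>M $ n\<bar> \<le> K * (1 / 4) ^ n"
  shows "0 \<le> moment_functional M ([:1, 1:] ^ k * [:1, -1:] ^ l)"
proof -
  define f :: "real fps" where
    "f = fps_binomial (real k / 2) * (fps_binomial (real l / 2) oo (- fps_X))"
  have sq: "fps_binomial (real n / 2) * fps_binomial (real n / 2) = (1 + fps_X) ^ n" for n
    by (simp add: fps_binomial_of_nat flip: fps_binomial_add_mult)
  have "f * f = (fps_binomial (real k / 2) * fps_binomial (real k / 2)) *
                 ((fps_binomial (real l / 2) * fps_binomial (real l / 2)) oo (- fps_X))"
    by (simp add: f_def fps_compose_mult_distrib mult_ac)
  also have "\<dots> = (1 + fps_X) ^ k * (1 - fps_X) ^ l"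
    unfolding sq by (simp add: fps_compose_power[symmetric] fps_compose_add_distrib)
  also have "\<dots> = fps_of_poly ([:1, 1:] ^ k * [:1, -1:] ^ l)"
    by (simp add: fps_of_poly_mult fps_of_poly_power fps_of_poly_pCons)
  finally have ff: "f * f = fps_of_poly ([:1, 1:] ^ k * [:1, -1:] ^ l)" .
  have "fps_conv_radius (fps_binomial (real l / 2) oo (- fps_X)) = fps_conv_radius (fps_binomial (real l / 2))"
    unfolding fps_compose_uminus' fps_conv_radius_def
    by (subst (1 2) conv_radius_norm[symmetric]) (simp add: abs_mult)
  moreover have "fps_conv_radius (fps_binomial (c :: real)) \<ge> 1" for c
    by (simp add: fps_conv_radius_binomial)
  ultimately have "1 \<le> fps_conv_radius f"
    unfolding f_def by (intro order_trans[OF _ fps_conv_radius_mult]) simp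
  hence "ereal (1 / 2) < fps_conv_radius f" 
    by (rule less_le_trans[rotated]) simp
  hence "summable (\<lambda>n. norm (f $ n * (1 / 2) ^ n))"
    by (intro norm_summable_fps) simp
  hence "bounded (range (\<lambda>n. norm (f $ n * (1 / 2) ^ n)))"
    by (intro summable_imp_bounded)
  then obtain A where A: "\<And>n. norm (f $ n * (1 / 2) ^ n) \<le> A"
    by (auto simp: bounded_iff)
  have "\<bar>f $ n\<bar> \<le> A * 2 ^ n" for n
    using A[of n] by (simp add: abs_mult power_one_over field_simps)
  thus ?thesis by (rule moment_functional_fps_square_nonneg[OF M M_bound _ ff])
qed

text \<open>
  The factorial moments of the binomial distribution: choosing \<open>k\<close> of \<open>n\<close> and then \<open>i\<close> of these \<open>k\<close> amounts
  to choosing the \<open>i\<close> first and then \<open>k - i\<close> of the others.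
\<close>

lemma Bernstein_factorial_moment:
  fixes Y Z :: "'a :: field_char_0 poly"
  assumes "i \<le> n" "Y + Z = 1"
  shows "(\<Sum>k\<le>n. of_nat (n choose k) * of_nat (k choose i) * (Y ^ k * Z ^ (n - k))) = of_nat (n choose i) * Y ^ i"
proof -
  have "(\<Sum>k\<le>n. of_nat (n choose k) * of_nat (k choose i) * (Y ^ k * Z ^ (n - k)))
      = (\<Sum>k=i..n. of_nat (n choose k) * of_nat (k choose i) * (Y ^ k * Z ^ (n - k)))"
    by (rule sum.mono_neutral_right) auto
  also have "\<dots> = (\<Sum>k=i..n. of_nat (n choose i) * (of_nat ((n - i) choose (k - i)) * (Y ^ k * Z ^ (n - k))))"
  proof (intro sum.cong refl)
    fix k assume "k \<in> {i..n}"
    hence "(n choose k) * (k choose i) = (n choose i) * ((n - i) choose (k - i))"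
      by (intro choose_mult) auto
    hence "(of_nat (n choose k) * of_nat (k choose i) :: 'a poly) = of_nat (n choose i) * of_nat ((n - i) choose (k - i))"
      by (metis of_nat_mult)
    thus "of_nat (n choose k) * of_nat (k choose i) * (Y ^ k * Z ^ (n - k))
        = of_nat (n choose i) * (of_nat ((n - i) choose (k - i)) * (Y ^ k * Z ^ (n - k)))"
      by (simp only: mult.assoc)
  qed
  also have "\<dots> = (\<Sum>k\<le>n - i. of_nat (n choose i) * (of_nat ((n - i) choose k) * (Y ^ (k + i) * Z ^ (n - (k + i)))))"
    by (rule sum.reindex_bij_witness[of _ "\<lambda>k. k + i" "\<lambda>k. k - i"]) (use assms in auto)
  also have "\<dots> = of_nat (n choose i) * Y ^ i * (\<Sum>k\<le>n - i. of_nat ((n - i) choose k) * Y ^ k * Z ^ (n - i - k))"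
    unfolding sum_distrib_left
  proof (intro sum.cong refl)
    fix k
    have "n - (k + i) = n - i - k" by simp
    thus "of_nat (n choose i) * (of_nat ((n - i) choose k) * (Y ^ (k + i) * Z ^ (n - (k + i))))
        = of_nat (n choose i) * Y ^ i * (of_nat ((n - i) choose k) * Y ^ k * Z ^ (n - i - k))"
      by (simp only: power_add mult_ac)
  qed
  also have "(\<Sum>k\<le>n - i. of_nat ((n - i) choose k) * Y ^ k * Z ^ (n - i - k)) = (Y + Z) ^ (n - i)"
    by (rule binomial_ring[symmetric])
  finally show ?thesis by (simp add: assms)
qed

text \<open>
  Both terms are products of \<open>i\<close> factors, \<open>k / n\<close> and \<open>(k - j) / (n - j)\<close> for \<open>j < i\<close>. Corresponding factors
  differ by at most \<open>j / (n - j)\<close>, and all partial products lie in \<open>[0, 1]\<close>.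
\<close>

lemma choose_ratio_approx:
  assumes "i < n" "k \<le> n"
  shows "\<bar>(real k / real n) ^ i - real (k choose i) / real (n choose i)\<bar> \<le> real i * (real i / (real n - real i))"
  using assms(1)
proof (induction i)
  case (Suc i)
  let ?g = "\<lambda>i. real (k choose i) / real (n choose i)" and ?y = "real k / real n"
  have pos: "real n - real i > 0" "real n > 0" using Suc.prems by auto
  have step: "real (m choose Suc i) * (real i + 1) = real (m choose i) * (real m - real i)" for m
    using gbinomial_mult_1[of "real m" i] by (simp add: binomial_gbinomial algebra_simps)
  have "?g (Suc i) = ?g i * ((real k - real i) / (real n - real i))"
  proof -
    have "?g (Suc i) = (real (k choose Suc i) * (real i + 1)) / (real (n choose Suc i) * (real i + 1))"
      by simp
    thus ?thesis by (simp only: step times_divide_times_eq)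
  qed
  hence "?y ^ Suc i - ?g (Suc i) = (?y ^ i - ?g i) * ?y + ?g i * (?y - (real k - real i) / (real n - real i))"
    by (simp add: algebra_simps)
  hence "\<bar>?y ^ Suc i - ?g (Suc i)\<bar> \<le> \<bar>?y ^ i - ?g i\<bar> * \<bar>?y\<bar> + \<bar>?g i\<bar> * \<bar>?y - (real k - real i) / (real n - real i)\<bar>"
    by (metis abs_mult abs_triangle_ineq)
  also have "\<dots> \<le> \<bar>?y ^ i - ?g i\<bar> * 1 + 1 * (real i / (real n - real i))"
  proof (intro add_mono mult_mono)
    show "\<bar>?y\<bar> \<le> 1" using assms(2) pos by simp
    have "k choose i \<le> n choose i" using assms(2) by (rule binomial_right_mono)
    thus "\<bar>?g i\<bar> \<le> 1" using Suc.prems by simp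
    have "?y - (real k - real i) / (real n - real i) = (real i / (real n - real i)) * ((real n - real k) / real n)"
      using pos by (simp add: field_simps)
    also have "\<bar>\<dots>\<bar> \<le> real i / (real n - real i) * 1"
      unfolding abs_mult using pos assms(2) by (intro mult_mono) auto
    finally show "\<bar>?y - (real k - real i) / (real n - real i)\<bar> \<le> real i / (real n - real i)" by simp
  qed auto
  also have "\<dots> \<le> real i * (real i / (real n - real i)) + real i / (real n - real i)"
    using Suc by simp
  also have "\<dots> = real (Suc i) * (real i / (real n - real i))"
    by (simp add: algebra_simps add_divide_distrib)
  also have "\<dots> \<le> real (Suc i) * (real (Suc i) / (real n - real (Suc i)))"
    using Suc.prems by (intro mult_left_mono frac_le) auto
  finally show ?case .
qed simp

text \<open>
  Let \<open>P n\<close> have mass \<open>w n k\<close> at the node \<open>k / n\<close>. Its normalized factorial moments are exactly the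
  required moments, and by the previous lemma they differ from the ordinary moments by \<open>O(1 / n)\<close>. So any
  weak limit of the \<open>P n\<close>, which Helly's theorem provides, has the required moments.
\<close>

lemma moment_measure_unit_interval:
  fixes w :: "nat \<Rightarrow> nat \<Rightarrow> real" and m :: "nat \<Rightarrow> real"
  assumes w_nonneg: "\<And>n k. k \<le> n \<Longrightarrow> 0 \<le> w n k"
    and w_sum: "\<And>n. (\<Sum>k\<le>n. w n k) = 1"
    and w_fact: "\<And>n i. i \<le> n \<Longrightarrow> (\<Sum>k\<le>n. w n k * (real (k choose i) / real (n choose i))) = m i"
  obtains \<nu> where "real_distribution \<nu>" "AE x in \<nu>. 0 \<le> x \<and> x \<le> 1" "\<And>i. (\<integral>x. x ^ i \<partial>\<nu>) = m i"
proof -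
  define P where "P n = distr (point_measure {..n} (\<lambda>k. ennreal (w n k))) borel (\<lambda>k. real k / real n)" for n
  have meas: "(\<lambda>k. real k / real n) \<in> borel_measurable (point_measure {..n} (\<lambda>k. ennreal (w n k)))" for n
    by (rule measurable_point_measure_eq1[THEN iffD2]) auto
  have P_dist: "real_distribution (P n)" for n
  proof -
    have "(\<Sum>k\<le>n. ennreal (w n k)) = ennreal (\<Sum>k\<le>n. w n k)"
      by (rule sum_ennreal) (use w_nonneg in auto)
    hence "emeasure (point_measure {..n} (\<lambda>k. ennreal (w n k))) {..n} = 1"
      by (simp add: emeasure_point_measure_finite w_sum)
    hence "prob_space (point_measure {..n} (\<lambda>k. ennreal (w n k)))"
      by (intro prob_spaceI) (simp add: space_point_measure)
    thus ?thesis unfolding P_def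
      by (rule prob_space.real_distribution_distr) (rule meas)
  qed
  have P_int: "(\<integral>x. f x \<partial>P n) = (\<Sum>k\<le>n. w n k * f (real k / real n))"
    if [measurable]: "f \<in> borel_measurable borel" for f :: "real \<Rightarrow> real" and n
    unfolding P_def
    by (subst integral_distr[OF meas that], subst lebesgue_integral_point_measure_finite)
       (use w_nonneg in auto)
  have P_AE: "AE x in P n. 0 \<le> x \<and> x \<le> 1" for n
    unfolding P_def by (subst AE_distr_iff[OF meas]) (auto simp: AE_point_measure divide_le_eq_1)
  have "tight P"
    unfolding tight_def
  proof (intro conjI allI impI P_dist)
    fix \<epsilon> :: real assume "\<epsilon> > 0"
    have "measure (P n) {-1<..1} = 1" for n
    proof -
      interpret real_distribution "P n" by (rule P_dist)
      have "AE x in P n. x \<in> {-1<..1}" using P_AE[of n] by eventually_elim auto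
      thus ?thesis by (subst prob_eq_1) auto
    qed
    thus "\<exists>a b. a < b \<and> (\<forall>n. 1 - \<epsilon> < measure (P n) {a<..b})"
      using \<open>\<epsilon> > 0\<close> by (intro exI[of _ "-1"] exI[of _ 1]) auto
  qed
  from tight_imp_convergent_subsubsequence[OF this strict_mono_id]
  obtain r \<nu> where r: "strict_mono (r :: nat \<Rightarrow> nat)" and \<nu>: "real_distribution \<nu>"
    and conv: "weak_conv_m (P \<circ> id \<circ> r) \<nu>"
    by blast
  interpret \<nu>: real_distribution \<nu> by (rule \<nu>)
  have lim: "(\<lambda>n. \<integral>x. f x \<partial>P (r n)) \<longlonglongrightarrow> (\<integral>x. f x \<partial>\<nu>)"
    if "\<And>x. isCont f x" "\<And>x. \<bar>f x\<bar> \<le> 1" for f :: "real \<Rightarrow> real"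
    using weak_conv_imp_integral_bdd_continuous_conv[OF _ \<nu> conv, of f 1] P_dist that by simp
  \<comment> \<open>truncation makes the monomials bounded, as weak convergence requires\<close>
  define clip where "clip x = max 0 (min 1 x)" for x :: real
  have clip_cont: "isCont clip x" for x
    unfolding clip_def by (intro continuous_intros)
  have clip_bounds: "0 \<le> clip x" "clip x \<le> 1" for x by (auto simp: clip_def)
  have clip_id: "clip x = x" if "0 \<le> x \<and> x \<le> 1" for x using that by (auto simp: clip_def)
  have supp: "AE x in \<nu>. 0 \<le> x \<and> x \<le> 1"
  proof -
    define h where "h x = min 1 \<bar>x - clip x\<bar>" for x
    have h_cont: "isCont h x" for x
      unfolding h_def by (intro continuous_intros clip_cont)
    hence [measurable]: "h \<in> borel_measurable borel"
      by (intro borel_measurable_continuous_onI continuous_at_imp_continuous_on) auto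
    have "(\<integral>x. h x \<partial>P n) = 0" for n
    proof -
      have "AE x in P n. h x = 0"
        using P_AE[of n] by eventually_elim (simp add: h_def clip_id)
      thus ?thesis by (rule integral_eq_zero_AE)
    qed
    moreover have "(\<lambda>n. \<integral>x. h x \<partial>P (r n)) \<longlonglongrightarrow> (\<integral>x. h x \<partial>\<nu>)"
      by (rule lim[OF h_cont]) (auto simp: h_def)
    ultimately have "(\<integral>x. h x \<partial>\<nu>) = 0" by (simp add: LIMSEQ_const_iff)
    moreover have "integrable \<nu> h"
      by (rule \<nu>.integrable_const_bound[of _ 1]) (auto simp: h_def)
    moreover have "AE x in \<nu>. 0 \<le> h x" by (auto simp: h_def)
    ultimately have "AE x in \<nu>. h x = 0"
      using integral_nonneg_eq_0_iff_AE by blast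
    thus ?thesis
      by eventually_elim (auto simp: h_def clip_def min_def max_def split: if_splits)
  qed
  have "(\<integral>x. x ^ i \<partial>\<nu>) = m i" for i
  proof -
    have [measurable]: "clip \<in> borel_measurable borel"
      using clip_cont by (intro borel_measurable_continuous_onI continuous_at_imp_continuous_on) auto
    have clip_int: "(\<integral>x. clip x ^ i \<partial>Q) = (\<integral>x. x ^ i \<partial>Q)"
      if "real_distribution Q" "AE x in Q. 0 \<le> x \<and> x \<le> 1" for Q
    proof -
      interpret real_distribution Q by fact
      have "AE x in Q. clip x ^ i = x ^ i"
        using that(2) by eventually_elim (simp add: clip_id)
      thus ?thesis by (intro integral_cong_AE) auto
    qed
    have "(\<lambda>n. \<integral>x. clip x ^ i \<partial>P (r n)) \<longlonglongrightarrow> (\<integral>x. clip x ^ i \<partial>\<nu>)"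
      by (rule lim) (auto intro!: continuous_intros clip_cont simp: power_le_one clip_bounds)
    hence A: "(\<lambda>n. \<integral>x. x ^ i \<partial>P (r n)) \<longlonglongrightarrow> (\<integral>x. x ^ i \<partial>\<nu>)"
      by (simp only: clip_int[OF P_dist P_AE] clip_int[OF \<nu> supp])
    have bound: "\<bar>(\<integral>x. x ^ i \<partial>P n) - m i\<bar> \<le> real i * (real i / (real n - real i))" if "i < n" for n
    proof -
      let ?e = "real i * (real i / (real n - real i))"
      have "(\<integral>x. x ^ i \<partial>P n) - m i
          = (\<Sum>k\<le>n. w n k * ((real k / real n) ^ i - real (k choose i) / real (n choose i)))"
        using w_fact[of i n] that by (simp add: P_int right_diff_distrib sum_subtractf)
      also have "\<bar>\<dots>\<bar> \<le> (\<Sum>k\<le>n. \<bar>w n k * ((real k / real n) ^ i - real (k choose i) / real (n choose i))\<bar>)"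
        by (rule sum_abs)
      also have "\<dots> \<le> (\<Sum>k\<le>n. w n k * ?e)"
        unfolding abs_mult using w_nonneg[of _ n] choose_ratio_approx[OF that]
        by (intro sum_mono mult_mono) auto
      also have "\<dots> = ?e" by (simp only: sum_distrib_right[symmetric] w_sum mult_1)
      finally show ?thesis .
    qed
    have "eventually (\<lambda>n. norm ((\<integral>x. x ^ i \<partial>P n) - m i) \<le> real i * (real i / (real n - real i))) sequentially"
      using eventually_gt_at_top[of i] by eventually_elim (use bound in simp)
    moreover have "(\<lambda>n. real i * (real i / (real n - real i))) \<longlonglongrightarrow> 0" by real_asymp
    ultimately have "(\<lambda>n. (\<integral>x. x ^ i \<partial>P n) - m i) \<longlonglongrightarrow> 0"
      by (rule Lim_null_comparison)
    hence "(\<lambda>n. \<integral>x. x ^ i \<partial>P n) \<longlonglongrightarrow> m i" by (simp add: LIM_zero_iff)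
    hence "(\<lambda>n. \<integral>x. x ^ i \<partial>P (r n)) \<longlonglongrightarrow> m i"
      using LIMSEQ_subseq_LIMSEQ[OF _ r] by (fastforce simp: o_def)
    with A show ?thesis by (rule LIMSEQ_unique)
  qed
  thus ?thesis using that \<nu> supp by blast
qed

text \<open>
  After a dilation the moments are bounded by \<open>K (1/4)\<^sup>n\<close>, and then the functional is nonnegative on the
  Bernstein polynomials in \<open>Y = (1 + X) / 2\<close>. Their values are the weights of discrete measures on
  \<open>[0, 1]\<close>; the limit of these is transported back by the affine change of variable.
\<close>

theorem bounded_Hamburger:
  assumes M: "positive_moments M" and radius: "fps_conv_radius M > 0"
  obtains \<mu> where "moment_measure \<mu> M"
proof -
  obtain K B where KB: "K \<ge> 1" "B > 0" "\<And>n. \<bar>M $ n\<bar> \<le> K * B ^ n"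
    using radius unfolding fps_conv_radius_pos_iff by blast
  \<comment> \<open>dilation factor that brings the growth rate of the moments down to \<open>1/4\<close>\<close>
  define s where "s = 1 / (4 * B)"
  have "s > 0" using KB by (simp add: s_def)
  define N where "N = M oo (fps_const s * fps_X)"
  have N_nth: "N $ n = s ^ n * M $ n" for n
    unfolding N_def by (simp only: fps_compose_linear fps_nth_Abs_fps)
  have N: "positive_moments N" unfolding N_def by (rule positive_moments_dilation[OF M])
  have N_bound: "\<bar>N $ n\<bar> \<le> K * (1 / 4) ^ n" for n
  proof -
    have "\<bar>N $ n\<bar> \<le> s ^ n * (K * B ^ n)"
      unfolding N_nth abs_mult using KB \<open>s > 0\<close> by (intro mult_mono) auto
    also have "\<dots> = K * (s * B) ^ n" by (simp add: power_mult_distrib)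
    also have "s * B = 1 / 4" using KB by (simp add: s_def)
    finally show ?thesis .
  qed
  let ?L = "moment_functional N"
  define Y Z :: "real poly" where "Y = [:1/2, 1/2:]" and "Z = [:1/2, -1/2:]"
  have YZ: "Y + Z = 1" by (simp add: Y_def Z_def one_pCons)
  have Y_smult: "Y = smult (1/2) [:1, 1:]" and Z_smult: "Z = smult (1/2) [:1, -1:]"
    by (simp_all add: Y_def Z_def)
  define w where "w n k = real (n choose k) * ?L (Y ^ k * Z ^ (n - k))" for n k
  have w_nonneg: "0 \<le> w n k" for n k
  proof -
    have "Y ^ k * Z ^ l = smult ((1/2) ^ l * (1/2) ^ k) ([:1, 1:] ^ k * [:1, -1:] ^ l)" for l
      unfolding Y_smult Z_smult smult_power
      by (simp only: mult_smult_left mult_smult_right smult_smult)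
    thus ?thesis
      using moment_functional_product_nonneg[OF N N_bound, of k "n - k"]
      by (simp add: w_def moment_functional_smult)
  qed
  have w_fact: "(\<Sum>k\<le>n. w n k * (real (k choose i) / real (n choose i))) = ?L (Y ^ i)" if "i \<le> n" for n i
  proof -
    have "real (n choose i) * ?L (Y ^ i) = ?L (of_nat (n choose i) * Y ^ i)"
      by (simp add: of_nat_poly moment_functional_smult)
    also have "\<dots> = (\<Sum>k\<le>n. real (n choose k) * (real (k choose i) * ?L (Y ^ k * Z ^ (n - k))))"
      by (subst Bernstein_factorial_moment[OF that YZ, symmetric])
         (simp add: of_nat_poly moment_functional_sum moment_functional_smult mult_ac)
    also have "\<dots> = (\<Sum>k\<le>n. w n k * real (k choose i))"
      by (simp add: w_def mult_ac)
    finally have "(\<Sum>k\<le>n. w n k * real (k choose i)) / real (n choose i) = ?L (Y ^ i)"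
      using that by (simp add: field_simps)
    thus ?thesis by (simp add: sum_divide_distrib)
  qed
  have "(\<Sum>k\<le>n. w n k) = 1" for n
    using w_fact[of 0 n] positive_moments_0[OF N] by simp
  then obtain \<nu> where \<nu>: "real_distribution \<nu>" "AE x in \<nu>. 0 \<le> x \<and> x \<le> 1"
    and \<nu>_moments: "\<And>i. (\<integral>x. x ^ i \<partial>\<nu>) = ?L (Y ^ i)"
    using moment_measure_unit_interval[of w "\<lambda>i. ?L (Y ^ i)"] w_nonneg w_fact by metis
  interpret \<nu>: real_distribution \<nu> by fact
  have \<nu>_int: "integrable \<nu> (\<lambda>x. x ^ i)" for i
  proof (rule \<nu>.integrable_const_bound[of _ 1])
    show "AE x in \<nu>. norm (x ^ i) \<le> 1"
      using \<nu>(2) by eventually_elim (simp add: power_le_one)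
  qed simp
  have \<nu>_poly: "(\<integral>x. poly p x \<partial>\<nu>) = ?L (pcompose p Y)" for p
  proof -
    have "(\<integral>x. poly p x \<partial>\<nu>) = (\<Sum>i\<le>degree p. coeff p i * ?L (Y ^ i))"
      unfolding poly_altdef \<nu>_moments[symmetric]
      by (subst Bochner_Integration.integral_sum) (auto intro: integrable_mult_right \<nu>_int)
    also have "\<dots> = ?L (\<Sum>i\<le>degree p. smult (coeff p i) (Y ^ i))"
      by (simp add: moment_functional_sum moment_functional_smult)
    also have "(\<Sum>i\<le>degree p. smult (coeff p i) (Y ^ i)) = pcompose p Y"
      unfolding pcompose_altdef poly_altdef by (simp add: degree_map_poly coeff_map_poly)
    finally show ?thesis .
  qed
  let ?\<phi> = "\<lambda>y. (2 * y - 1) / s"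
  define \<mu> where "\<mu> = distr \<nu> borel ?\<phi>"
  have "moment_measure \<mu> M"
    unfolding moment_measure_def
  proof (intro conjI allI)
    show "real_distribution \<mu>" unfolding \<mu>_def by (rule \<nu>.real_distribution_distr) simp
    show "\<exists>B>0. AE x in \<mu>. \<bar>x\<bar> \<le> B"
    proof (intro exI[of _ "1 / s"] conjI)
      show "AE x in \<mu>. \<bar>x\<bar> \<le> 1 / s"
      proof -
        have "AE y in \<nu>. \<bar>?\<phi> y\<bar> \<le> 1 / s"
          using \<nu>(2) by eventually_elim (use \<open>s > 0\<close> in \<open>simp add: abs_le_iff divide_right_mono\<close>)
        thus ?thesis unfolding \<mu>_def by (subst AE_distr_iff) simp_all
      qed
    qed (use \<open>s > 0\<close> in simp)
    fix n
    have "(\<integral>x. x ^ n \<partial>\<mu>) = (\<integral>y. (1 / s) ^ n * poly ([:-1, 2:] ^ n) y \<partial>\<nu>)"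
      unfolding \<mu>_def by (subst integral_distr) (auto simp: power_divide algebra_simps)
    also have "\<dots> = (1 / s) ^ n * (\<integral>y. poly ([:-1, 2:] ^ n) y \<partial>\<nu>)"
      by (rule integral_mult_right_zero)
    also have "\<dots> = (1 / s) ^ n * ?L (pcompose ([:-1, 2:] ^ n) Y)"
      by (simp only: \<nu>_poly)
    also have "pcompose ([:-1, 2:] ^ n) Y = monom 1 n"
    proof (induction n)
      case (Suc n)
      have "pcompose [:-1, 2:] Y = monom 1 1"
        by (simp add: pcompose_pCons Y_def monom_Suc monom_0)
      thus ?case
        by (simp only: power_Suc pcompose_mult Suc mult_monom) simp
    qed (simp add: pcompose_1)
    finally show "(\<integral>x. x ^ n \<partial>\<mu>) = M $ n"
      using \<open>s > 0\<close> by (simp add: N_nth power_one_over)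
  qed
  thus ?thesis using that by blast
qed

section \<open>Mixtures of resolvents preserve positivity\<close>

text \<open>
  Each coefficient is linear in \<open>R\<close>. For the point mass at \<open>x\<close> it is the \<open>n\<close>-th coefficient of
  \<open>1 / (D - x z)\<close>, so this is the value at \<open>x\<close> of the polynomial on the right.
\<close>

lemma mixed_resolvent_nth:
  "mixed_resolvent R D $ n =
     moment_functional R (\<Sum>k\<le>n. monom ((inverse D * (fps_X * inverse D) ^ k) $ n) k)"
proof -
  let ?U = "fps_X * inverse D"
  have U: "(?U ^ k) $ j = 0" if "j < k" for j k
    using that by (simp add: power_mult_distrib fps_X_power_mult_nth)
  have "mixed_resolvent R D $ n = (\<Sum>j\<le>n. inverse D $ (n - j) * (\<Sum>k\<le>j. R $ k * (?U ^ k) $ j))"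
    unfolding mixed_resolvent_def mult.commute[of "inverse D" "R oo ?U"]
    by (subst fps_mult_nth) (simp add: atLeast0AtMost fps_compose_nth mult.commute)
  also have "\<dots> = (\<Sum>j\<le>n. inverse D $ (n - j) * (\<Sum>k\<le>n. R $ k * (?U ^ k) $ j))"
    by (intro sum.cong refl arg_cong2[of _ _ _ _ "(*)"] sum.mono_neutral_left) (auto simp: U)
  also have "\<dots> = (\<Sum>k\<le>n. R $ k * (\<Sum>j\<le>n. (?U ^ k) $ j * inverse D $ (n - j)))"
    unfolding sum_distrib_left by (subst sum.swap) (simp only: mult_ac)
  also have "\<dots> = (\<Sum>k\<le>n. R $ k * (?U ^ k * inverse D) $ n)"
    by (simp only: fps_mult_nth[of "?U ^ _" "inverse D"] atLeast0AtMost)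
  also have "\<dots> = moment_functional R (\<Sum>k\<le>n. monom ((inverse D * ?U ^ k) $ n) k)"
    by (simp only: moment_functional_sum moment_functional_monom mult.commute)
  finally show ?thesis .
qed

lemma mixed_resolvent_dirac:
  assumes "D $ 0 \<noteq> 0"
  shows "mixed_resolvent (Abs_fps (\<lambda>n. x ^ n)) D * (D - fps_const x * fps_X) = 1"
proof -
  let ?G = "Abs_fps (\<lambda>n. x ^ n)" and ?U = "fps_X * inverse D"
  have D: "D * inverse D = 1" using assms by (rule inverse_mult_eq_1')
  have "?G * (1 - fps_const x * fps_X) = 1"
  proof (rule fps_ext)
    fix n
    have "?G * (1 - fps_const x * fps_X) = ?G - fps_const x * (fps_X * ?G)"
      by (simp add: algebra_simps)
    thus "(?G * (1 - fps_const x * fps_X)) $ n = 1 $ n"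
      by (cases n) simp_all
  qed
  hence "(?G * (1 - fps_const x * fps_X)) oo ?U = 1" by simp
  hence G: "(?G oo ?U) * (1 - fps_const x * ?U) = 1"
    by (simp add: fps_compose_mult_distrib fps_compose_sub_distrib)
  have "mixed_resolvent ?G D * (D - fps_const x * fps_X)
      = (?G oo ?U) * (inverse D * D - fps_const x * ?U)"
    by (simp add: mixed_resolvent_def algebra_simps)
  also have "inverse D * D = 1" using D by (simp add: mult.commute)
  finally show ?thesis using G by simp
qed

lemma moment_functional_dirac: "moment_functional (Abs_fps (\<lambda>n. x ^ n)) p = poly p x"
  by (simp add: moment_functional_def poly_altdef)

text \<open>
  For each \<open>x\<close> the series \<open>1 / (D - x z)\<close> is a continued fraction step over \<open>T\<close> with \<open>a + x\<close> in place of \<open>a\<close>,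
  hence positive. Its Hankel form is the value at \<open>x\<close> of the polynomial \<open>?p\<close> below, so \<open>?p\<close> is
  nonnegative on the real line, and so is its integral against a measure with moment series \<open>R\<close>.
\<close>

lemma positive_moments_mixed_resolvent:
  assumes R: "positive_moments R" "fps_conv_radius R > 0"
    and T: "positive_moments T" and b: "b \<ge> 0"
    and D: "D = 1 - fps_const a * fps_X - fps_const b * fps_X\<^sup>2 * T"
  shows "positive_moments (mixed_resolvent R D)"
proof (rule positive_momentsI)
  obtain \<rho> where \<rho>: "moment_measure \<rho> R" using bounded_Hamburger[OF R] by blast
  have D0: "D $ 0 = 1" by (simp add: D)
  thus "mixed_resolvent R D $ 0 = 1"
    using positive_moments_0[OF R(1)] by (simp add: mixed_resolvent_def)
  fix c :: "nat \<Rightarrow> real" and n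
  let ?q = "\<lambda>n. \<Sum>k\<le>n. monom ((inverse D * (fps_X * inverse D) ^ k) $ n) k"
  let ?p = "\<Sum>i\<le>n. \<Sum>j\<le>n. smult (c i * c j) (?q (i + j))"
  have quadratic: "(\<Sum>i\<le>n. \<Sum>j\<le>n. c i * c j * mixed_resolvent S D $ (i + j)) = moment_functional S ?p" for S
    unfolding mixed_resolvent_nth by (simp only: moment_functional_sum moment_functional_smult)
  have "0 \<le> poly ?p x" for x
  proof -
    let ?G = "Abs_fps (\<lambda>n. x ^ n)"
    have "mixed_resolvent ?G D * (1 - fps_const (a + x) * fps_X - fps_const b * fps_X\<^sup>2 * T) = 1"
      using mixed_resolvent_dirac[of D x] D0
      by (simp add: D algebra_simps flip: fps_const_add)
    hence "positive_moments (mixed_resolvent ?G D)"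
      by (rule positive_moments_first_return[OF T b])
    from positive_moments_quadratic_form[OF this, of c n] show ?thesis
      by (simp only: quadratic moment_functional_dirac)
  qed
  hence "0 \<le> moment_functional R ?p"
    unfolding moment_functional_eq_integral[OF \<rho>] by (rule Bochner_Integration.integral_nonneg)
  thus "0 \<le> (\<Sum>i\<le>n. \<Sum>j\<le>n. c i * c j * mixed_resolvent R D $ (i + j))"
    by (simp only: quadratic)
qed

text \<open>
  Agreement with a positive series in the first \<open>n\<close> coefficients: the induction invariant for fixed
  point equations.
\<close>

definition positive_moments_upto :: "nat \<Rightarrow> real fps \<Rightarrow> bool" where
  "positive_moments_upto n S \<longleftrightarrow> (\<exists>T. positive_moments T \<and> (\<forall>i<n. T $ i = S $ i))"

lemma positive_moments_upto_0: "positive_moments_upto 0 S"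
  using positive_moments_1 by (auto simp: positive_moments_upto_def)

lemma positive_moments_upto_all: "(\<And>n. positive_moments_upto n S) \<Longrightarrow> positive_moments S"
  unfolding positive_moments_upto_def by (rule positive_moments_agree)

text \<open>
  One more coefficient is gained because \<open>S\<close> enters \<open>D\<close> with a factor \<open>z\<^sup>2\<close>.
\<close>

lemma positive_moments_upto_mixed_resolvent:
  assumes R: "positive_moments R" "fps_conv_radius R > 0"
    and S: "positive_moments_upto n S" and b: "b \<ge> 0"
    and D: "D = 1 - fps_const a * fps_X - fps_const b * fps_X\<^sup>2 * S"
  shows "positive_moments_upto (Suc n) (mixed_resolvent R D)"
proof -
  obtain T where T: "positive_moments T" "\<forall>i<n. T $ i = S $ i"
    using S by (auto simp: positive_moments_upto_def)
  let ?E = "1 - fps_const a * fps_X - fps_const b * fps_X\<^sup>2 * T"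
  have "\<forall>i<Suc n. ?E $ i = D $ i"
    using T(2) by (auto simp: D mult.assoc fps_X_power_mult_nth)
  hence "\<forall>i<Suc n. mixed_resolvent R ?E $ i = mixed_resolvent R D $ i"
    by (rule fps_agree_mixed_resolvent) (simp_all add: D)
  moreover have "positive_moments (mixed_resolvent R ?E)"
    by (rule positive_moments_mixed_resolvent[OF R T(1) b refl])
  ultimately show ?thesis unfolding positive_moments_upto_def by blast
qed

section \<open>The class of free cumulant series\<close>

text \<open>
  The series \<open>1 + z R(z)\<close>, where \<open>R\<close> is the R-transform of a compactly supported probability
  measure. The functional equation \<open>C(z M(z)) = M(z)\<close> is the moment-cumulant formula.
\<close>

definition free_cumulant_class :: "real fps set" where
  "free_cumulant_class =
     {C. fps_conv_radius C > 0 \<and> (\<exists>M. positive_moments M \<and> C oo (fps_X * M) = M)}"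

lemma free_cumulant_class_nth_0: "C \<in> free_cumulant_class \<Longrightarrow> C $ 0 = 1"
  unfolding free_cumulant_class_def
  by (auto dest!: positive_moments_0) (metis fps_compose_nth_0)

text \<open>
  Both a law in the class and its first continued fraction step \<open>R\<close> are again given by measures, since
  their series have positive radius of convergence.
\<close>

lemma free_cumulant_classE:
  assumes "C \<in> free_cumulant_class"
  obtains M a b R where "C oo (fps_X * M) = M" "positive_moments M" "fps_conv_radius M > 0"
    "b \<ge> 0" "positive_moments R" "fps_conv_radius R > 0"
    "M * (1 - fps_const a * fps_X - fps_const b * fps_X\<^sup>2 * R) = 1"
proof -
  obtain M where C: "fps_conv_radius C > 0" and M: "positive_moments M" "C oo (fps_X * M) = M"
    using assms by (auto simp: free_cumulant_class_def)
  have rM: "fps_conv_radius M > 0" by (rule fps_conv_radius_free_moments[OF C M(2)])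
  obtain a b R where R: "b \<ge> 0" "positive_moments R"
    "M * (1 - fps_const a * fps_X - fps_const b * fps_X\<^sup>2 * R) = 1" "b = 0 \<Longrightarrow> R = 1"
    using positive_moments_obtain_first_return[OF M(1)] by metis
  have "fps_conv_radius R > 0"
  proof (cases "b = 0")
    case False
    have "inverse M = 1 - fps_const a * fps_X - fps_const b * fps_X\<^sup>2 * R"
      using R(3) by (metis fps_inverse_unique)
    hence "fps_const b * (fps_X\<^sup>2 * R) = 1 - fps_const a * fps_X - inverse M" by (simp add: mult.assoc)
    moreover have "fps_conv_radius (1 - fps_const a * fps_X - inverse M) > 0"
      by (intro fps_conv_radius_diff_pos fps_conv_radius_mult_pos fps_conv_radius_inverse_pos)
         (simp_all add: rM positive_moments_0[OF M(1)])
    ultimately have "fps_conv_radius (fps_shift 2 (fps_X\<^sup>2 * R)) > 0"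
      using False by (metis fps_conv_radius_cmult_left fps_conv_radius_shift)
    thus ?thesis by (simp add: fps_shift_times_fps_X_power mult.commute)
  qed (use R(4) in simp)
  thus ?thesis using that M rM R by blast
qed

lemma free_cumulant_classI:
  "fps_conv_radius C > 0 \<Longrightarrow> C oo (fps_X * M) = M \<Longrightarrow> positive_moments M \<Longrightarrow> C \<in> free_cumulant_class"
  by (auto simp: free_cumulant_class_def)

text \<open>
  Free additive convolution. The two subordination functions satisfy \<open>D1 + D2 = 1 + 1 / M\<close>. Together with
  the first part of \<open>subordination_step\<close> this expresses \<open>D1\<close> through \<open>S2\<close> and \<open>D2\<close> through \<open>S1\<close>, so \<open>S1\<close> and
  \<open>S2\<close> solve a coupled pair of fixed point equations and are positive by simultaneous induction.
\<close>

theorem free_cumulant_class_add: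
  assumes C1: "C1 \<in> free_cumulant_class" and C2: "C2 \<in> free_cumulant_class"
  shows "C1 + C2 - 1 \<in> free_cumulant_class"
proof -
  obtain M1 a1 b1 R1 where 1: "C1 oo (fps_X * M1) = M1" "positive_moments M1" "fps_conv_radius M1 > 0"
    "b1 \<ge> 0" "positive_moments R1" "fps_conv_radius R1 > 0"
    "M1 * (1 - fps_const a1 * fps_X - fps_const b1 * fps_X\<^sup>2 * R1) = 1"
    by (rule free_cumulant_classE[OF C1])
  obtain M2 a2 b2 R2 where 2: "C2 oo (fps_X * M2) = M2" "positive_moments M2" "fps_conv_radius M2 > 0"
    "b2 \<ge> 0" "positive_moments R2" "fps_conv_radius R2 > 0"
    "M2 * (1 - fps_const a2 * fps_X - fps_const b2 * fps_X\<^sup>2 * R2) = 1"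
    by (rule free_cumulant_classE[OF C2])
  note C0 = free_cumulant_class_nth_0[OF C1] free_cumulant_class_nth_0[OF C2]
  obtain M where M: "(C1 + C2 - 1) oo (fps_X * M) = M"
    using free_moments_exist[of "C1 + C2 - 1"] C0 by auto
  have M0: "M $ 0 = 1" using arg_cong[OF M, of "\<lambda>f. f $ 0"] C0 by simp
  define D1 where "D1 = (C1 oo (fps_X * M)) * inverse M"
  define D2 where "D2 = (C2 oo (fps_X * M)) * inverse M"
  define S1 where "S1 = mixed_resolvent R1 D1"
  define S2 where "S2 = mixed_resolvent R2 D2"
  have inv: "M * inverse M = 1" using M0 by (intro inverse_mult_eq_1') simp
  have "(C1 oo (fps_X * M)) + (C2 oo (fps_X * M)) = M + 1"
    using M by (simp add: fps_compose_add_distrib fps_compose_sub_distrib algebra_simps)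
  hence "D1 + D2 = (M + 1) * inverse M"
    unfolding D1_def D2_def by (simp flip: distrib_right)
  hence D12: "D1 + D2 = 1 + inverse M"
    using inv by (simp add: algebra_simps)
  have s1: "D1 - fps_const a1 * fps_X - fps_const b1 * fps_X\<^sup>2 * S1 = inverse M"
    unfolding S1_def D1_def by (rule subordination_step(1)[OF 1(1) positive_moments_0[OF 1(2)] 1(7) M0])
  have s2: "D2 - fps_const a2 * fps_X - fps_const b2 * fps_X\<^sup>2 * S2 = inverse M"
    unfolding S2_def D2_def by (rule subordination_step(1)[OF 2(1) positive_moments_0[OF 2(2)] 2(7) M0])
  have D1: "D1 = 1 - fps_const a2 * fps_X - fps_const b2 * fps_X\<^sup>2 * S2"
    using D12 s2 by (simp add: algebra_simps)
  have D2: "D2 = 1 - fps_const a1 * fps_X - fps_const b1 * fps_X\<^sup>2 * S1"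
    using D12 s1 by (simp add: algebra_simps)
  have "positive_moments_upto n S1 \<and> positive_moments_upto n S2" for n
  proof (induction n)
    case (Suc n)
    thus ?case
      using positive_moments_upto_mixed_resolvent[OF 1(5,6) _ 2(4) D1, of n]
        positive_moments_upto_mixed_resolvent[OF 2(5,6) _ 1(4) D2, of n]
      by (simp add: S1_def S2_def)
  qed (simp add: positive_moments_upto_0)
  hence "positive_moments S2" by (blast intro: positive_moments_upto_all)
  hence "positive_moments (mixed_resolvent M1 D1)"
    by (rule positive_moments_mixed_resolvent[OF 1(2,3) _ 2(4) D1])
  moreover have "mixed_resolvent M1 D1 = M"
    unfolding D1_def by (rule subordination_step(2)[OF 1(1) positive_moments_0[OF 1(2)] 1(7) M0])
  moreover have "fps_conv_radius (C1 + C2 - 1) > 0"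
    using C1 C2 by (intro fps_conv_radius_diff_pos fps_conv_radius_add_pos) (auto simp: free_cumulant_class_def)
  ultimately show ?thesis using M by (intro free_cumulant_classI[of _ M]) simp_all
qed

text \<open>
  Free convolution powers. Now there is one subordination function, with \<open>c D = 1 + (c - 1) / M\<close>, and \<open>S\<close>
  solves a single fixed point equation. The condition \<open>c \<ge> 1\<close> makes the coefficient \<open>(c - 1) b\<close> of \<open>S\<close>
  in \<open>D\<close> nonnegative.
\<close>

theorem free_cumulant_class_power:
  assumes C: "C \<in> free_cumulant_class" and c: "c \<ge> 1"
  shows "fps_const c * C - fps_const (c - 1) \<in> free_cumulant_class"
proof -
  let ?C = "fps_const c * C - fps_const (c - 1)"
  obtain N a b R where N: "C oo (fps_X * N) = N" "positive_moments N" "fps_conv_radius N > 0"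
    "b \<ge> 0" "positive_moments R" "fps_conv_radius R > 0"
    "N * (1 - fps_const a * fps_X - fps_const b * fps_X\<^sup>2 * R) = 1"
    by (rule free_cumulant_classE[OF C])
  note C0 = free_cumulant_class_nth_0[OF C]
  obtain M where M: "?C oo (fps_X * M) = M"
    using free_moments_exist[of ?C] C0 by auto
  have M0: "M $ 0 = 1" using arg_cong[OF M, of "\<lambda>f. f $ 0"] C0 by simp
  define D where "D = (C oo (fps_X * M)) * inverse M"
  define S where "S = mixed_resolvent R D"
  have inv: "M * inverse M = 1" using M0 by (intro inverse_mult_eq_1') simp
  have "fps_const c * (C oo (fps_X * M)) = M + fps_const (c - 1)"
    using M by (simp add: fps_compose_sub_distrib fps_const_mult_apply_left algebra_simps)
  hence "fps_const c * D = (M + fps_const (c - 1)) * inverse M"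
    unfolding D_def by (simp only: mult.assoc[symmetric])
  hence cD: "fps_const c * D = 1 + fps_const (c - 1) * inverse M"
    using inv by (simp add: distrib_right)
  have s: "D - fps_const a * fps_X - fps_const b * fps_X\<^sup>2 * S = inverse M"
    unfolding S_def D_def by (rule subordination_step(1)[OF N(1) positive_moments_0[OF N(2)] N(7) M0])
  have "D = fps_const c * D - fps_const (c - 1) * D"
    by (simp add: algebra_simps flip: fps_const_sub)
  also have "\<dots> = 1 - fps_const (c - 1) * (D - inverse M)"
    unfolding cD by (simp add: algebra_simps)
  also have "D - inverse M = fps_const a * fps_X + fps_const b * fps_X\<^sup>2 * S"
    unfolding s[symmetric] by simp
  finally have D: "D = 1 - fps_const ((c - 1) * a) * fps_X - fps_const ((c - 1) * b) * fps_X\<^sup>2 * S"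
    by (simp only: fps_const_mult[symmetric] distrib_left mult.assoc diff_diff_eq)
  have b': "(c - 1) * b \<ge> 0" using c N(4) by simp
  have "positive_moments_upto n S" for n
  proof (induction n)
    case (Suc n)
    thus ?case
      using positive_moments_upto_mixed_resolvent[OF N(5,6) _ b' D, of n] by (simp add: S_def)
  qed (simp add: positive_moments_upto_0)
  hence "positive_moments S" by (blast intro: positive_moments_upto_all)
  hence "positive_moments (mixed_resolvent N D)"
    by (rule positive_moments_mixed_resolvent[OF N(2,3) _ b' D])
  moreover have "mixed_resolvent N D = M"
    unfolding D_def by (rule subordination_step(2)[OF N(1) positive_moments_0[OF N(2)] N(7) M0])
  moreover have "fps_conv_radius ?C > 0"
    using C by (intro fps_conv_radius_diff_pos fps_conv_radius_mult_pos) (auto simp: free_cumulant_class_def)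
  ultimately show ?thesis using M by (intro free_cumulant_classI[of _ M]) simp_all
qed

text \<open>
  The moment series of the semicircle law is the fixed point of \<open>M = 1 / (1 - v z\<^sup>2 M)\<close>.
\<close>

lemma free_cumulant_class_semicircle:
  assumes "v \<ge> 0"
  shows "1 + fps_const v * fps_X\<^sup>2 \<in> free_cumulant_class"
proof -
  let ?C = "1 + fps_const v * fps_X\<^sup>2"
  obtain M where M: "?C oo (fps_X * M) = M"
    using free_moments_exist[of ?C] by auto
  have M0: "M $ 0 = 1" using arg_cong[OF M, of "\<lambda>f. f $ 0"] by simp
  define D where "D = 1 - fps_const 0 * fps_X - fps_const v * fps_X\<^sup>2 * M"
  have "M * D = 1"
    using M by (simp add: D_def fps_compose_add_distrib fps_compose_mult_distrib power2_eq_square algebra_simps)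
  hence "mixed_resolvent 1 D = M"
    by (simp add: mixed_resolvent_def) (metis fps_inverse_unique mult.commute)
  moreover have "positive_moments_upto n M" for n
  proof (induction n)
    case (Suc n)
    have "positive_moments_upto (Suc n) (mixed_resolvent 1 D)"
      by (rule positive_moments_upto_mixed_resolvent[OF positive_moments_1 _ Suc assms D_def]) simp
    thus ?case using \<open>mixed_resolvent 1 D = M\<close> by simp
  qed (simp add: positive_moments_upto_0)
  hence "positive_moments M" by (rule positive_moments_upto_all)
  moreover have "fps_conv_radius ?C > 0"
    by (intro fps_conv_radius_add_pos fps_conv_radius_mult_pos) simp_all
  ultimately show ?thesis using M by (intro free_cumulant_classI)
qed

lemma free_cumulant_class_dirac: "1 + fps_const a * fps_X \<in> free_cumulant_class"
proof -
  let ?M = "Abs_fps (\<lambda>n. a ^ n)"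
  have "?M = 1 + fps_const a * (fps_X * ?M)"
  proof (rule fps_ext)
    fix n show "?M $ n = (1 + fps_const a * (fps_X * ?M)) $ n"
      by (cases n) simp_all
  qed
  hence "(1 + fps_const a * fps_X) oo (fps_X * ?M) = ?M"
    by (simp add: fps_compose_add_distrib fps_compose_mult_distrib)
  moreover have "fps_conv_radius (1 + fps_const a * fps_X) > 0"
    by (intro fps_conv_radius_add_pos fps_conv_radius_mult_pos) simp_all
  ultimately show ?thesis
    using positive_moments_dirac[of a] by (intro free_cumulant_classI)
qed

lemma free_cumulant_class_dilation:
  assumes "C \<in> free_cumulant_class"
  shows "C oo (fps_const c * fps_X) \<in> free_cumulant_class"
proof -
  let ?c = "fps_const c * fps_X"
  obtain M where C: "fps_conv_radius C > 0" and M: "positive_moments M" "C oo (fps_X * M) = M"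
    using assms by (auto simp: free_cumulant_class_def)
  have "(C oo ?c) oo (fps_X * (M oo ?c)) = C oo (?c oo (fps_X * (M oo ?c)))"
    by (rule fps_compose_assoc[symmetric]) simp_all
  also have "?c oo (fps_X * (M oo ?c)) = (fps_X * M) oo ?c"
    by (simp add: fps_compose_mult_distrib mult_ac)
  also have "C oo ((fps_X * M) oo ?c) = M oo ?c"
    by (subst fps_compose_assoc) (simp_all add: M)
  finally show ?thesis
    by (intro free_cumulant_classI[of _ "M oo ?c"] fps_conv_radius_dilation_pos C positive_moments_dilation M)
qed

lemma fps_mult_nth_LIMSEQ:
  fixes F G :: "nat \<Rightarrow> real fps"
  assumes "\<And>i. i \<le> n \<Longrightarrow> (\<lambda>k. F k $ i) \<longlonglongrightarrow> f $ i" "\<And>i. i \<le> n \<Longrightarrow> (\<lambda>k. G k $ i) \<longlonglongrightarrow> g $ i"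
  shows "(\<lambda>k. (F k * G k) $ n) \<longlonglongrightarrow> (f * g) $ n"
  unfolding fps_mult_nth by (intro tendsto_sum tendsto_mult assms) auto

lemma fps_power_nth_LIMSEQ:
  fixes F :: "nat \<Rightarrow> real fps"
  assumes "\<And>i. i \<le> n \<Longrightarrow> (\<lambda>k. F k $ i) \<longlonglongrightarrow> f $ i"
  shows "(\<lambda>k. (F k ^ m) $ n) \<longlonglongrightarrow> (f ^ m) $ n"
  using assms
proof (induction m arbitrary: n)
  case (Suc m)
  show ?case unfolding power_Suc
    by (intro fps_mult_nth_LIMSEQ Suc) auto
qed simp

text \<open>
  A moment is a polynomial in the cumulants up to its order, hence depends continuously on them.
\<close>

lemma free_cumulant_class_LIMSEQ:
  assumes radius: "fps_conv_radius C > 0" and C: "\<And>k. D k \<in> free_cumulant_class"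
    and lim: "\<And>n. (\<lambda>k. D k $ n) \<longlonglongrightarrow> C $ n"
  shows "C \<in> free_cumulant_class"
proof -
  have "\<forall>k. \<exists>T. positive_moments T \<and> D k oo (fps_X * T) = T"
    using C by (auto simp: free_cumulant_class_def)
  then obtain T where T: "\<And>k. positive_moments (T k)" "\<And>k. D k oo (fps_X * T k) = T k"
    by metis
  have "(\<lambda>k. D k $ 0) \<longlonglongrightarrow> 1" using C by (simp add: free_cumulant_class_nth_0)
  hence C0: "C $ 0 = 1" using lim[of 0] LIMSEQ_unique by blast
  obtain M where M: "C oo (fps_X * M) = M"
    using free_moments_exist[of C] C0 by auto
  have "(\<lambda>k. T k $ n) \<longlonglongrightarrow> M $ n" for n
  proof (induction n rule: less_induct)
    case (less n)
    have "(\<lambda>k. \<Sum>i=0..n. D k $ i * ((fps_X * T k) ^ i) $ n) \<longlonglongrightarrow> (\<Sum>i=0..n. C $ i * ((fps_X * M) ^ i) $ n)"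
    proof (intro tendsto_sum tendsto_mult lim)
      fix i assume "i \<in> {0..n}"
      show "(\<lambda>k. ((fps_X * T k) ^ i) $ n) \<longlonglongrightarrow> ((fps_X * M) ^ i) $ n"
      proof (cases "i = 0")
        case False
        have "(\<lambda>k. (T k ^ i) $ (n - i)) \<longlonglongrightarrow> (M ^ i) $ (n - i)"
          by (rule fps_power_nth_LIMSEQ, rule less) (use False \<open>i \<in> {0..n}\<close> in auto)
        thus ?thesis
          using \<open>i \<in> {0..n}\<close> by (simp add: power_mult_distrib fps_X_power_mult_nth)
      qed simp
    qed
    thus ?case
      unfolding fps_compose_nth[symmetric] T(2) M .
  qed
  hence "positive_moments M" by (rule positive_moments_LIMSEQ[OF T(1)])
  thus ?thesis by (intro free_cumulant_classI[OF radius M])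
qed

section \<open>Power series expansions of real functions\<close>

text \<open>
  The zeros of a nonzero power series are isolated, on the real line as well.
\<close>

lemma has_fps_expansion_real_unique:
  fixes f :: "real \<Rightarrow> real"
  assumes "f has_fps_expansion F" "f has_fps_expansion G"
  shows "F = G"
proof -
  let ?H = "F - G"
  have "(\<lambda>x. f x - f x) has_fps_expansion ?H" by (intro has_fps_expansion_diff assms)
  hence radius: "fps_conv_radius ?H > 0" and ev: "eventually (\<lambda>x. eval_fps ?H x = 0) (nhds 0)"
    by (simp_all add: has_fps_expansion_def)
  obtain r where r: "0 < ereal r" "ereal r < fps_conv_radius ?H"
    using radius ereal_dense2 by blast
  obtain d where d: "d > 0" "\<And>x. dist x 0 < d \<Longrightarrow> eval_fps ?H x = 0"
    using ev unfolding eventually_nhds_metric by blast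
  have H0: "eval_fps ?H 0 = 0" using d by simp
  have "?H $ m = 0" for m
  proof (rule ccontr)
    assume m: "?H $ m \<noteq> 0"
    hence "m > 0" using H0 by (cases m) (simp_all add: eval_fps_at_0)
    have sums: "(\<lambda>n. ?H $ n * (x - 0) ^ n) sums eval_fps ?H x" if "norm (x - 0) < r" for x
    proof -
      have "ereal (norm x) < fps_conv_radius ?H"
        using that r(2) by (metis diff_zero ereal_less(2) less_trans less_ereal.simps(1))
      thus ?thesis using sums_eval_fps[of x ?H] by simp
    qed
    obtain s where s: "0 < s" "\<And>z. z \<in> cball 0 s - {0} \<Longrightarrow> eval_fps ?H z \<noteq> 0"
      using powser_0_nonzero[OF _ sums H0 m \<open>m > 0\<close>] r(1) by (metis ereal_less(2))
    define z where "z = min s (d / 2)"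
    have "z > 0" "z \<le> s" "z < d" using s(1) d(1) by (auto simp: z_def min_def)
    thus False using s(2)[of z] d(2)[of z] by (auto simp: dist_norm)
  qed
  thus ?thesis by (simp add: fps_eq_iff)
qed

text \<open>
  Real series are extended to the complex plane, where a composite of expansions is again an expansion
  because composites of holomorphic functions are holomorphic.
\<close>

definition complexify :: "real fps \<Rightarrow> complex fps" where
  "complexify F = Abs_fps (\<lambda>n. complex_of_real (F $ n))"

lemma complexify_nth [simp]: "complexify F $ n = complex_of_real (F $ n)"
  by (simp add: complexify_def)

lemma complexify_radius [simp]: "fps_conv_radius (complexify F) = fps_conv_radius F"
  unfolding fps_conv_radius_def by (subst (1 2) conv_radius_norm[symmetric]) simp

lemma complexify_power: "complexify (F ^ n) = complexify F ^ n"
proof (induction n)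
  case (Suc n)
  have "complexify (F * G) = complexify F * complexify G" for F G
    by (simp add: fps_eq_iff fps_mult_nth)
  thus ?case by (simp add: Suc)
qed (simp add: fps_eq_iff)

lemma complexify_compose: "complexify (F oo G) = complexify F oo complexify G"
  by (simp add: fps_eq_iff fps_compose_nth flip: complexify_power)

lemma complexify_eval:
  assumes "ereal \<bar>x\<bar> < fps_conv_radius F"
  shows "eval_fps (complexify F) (of_real x) = of_real (eval_fps F x)"
proof -
  have "(\<lambda>n. F $ n * x ^ n) sums eval_fps F x" using assms by (intro sums_eval_fps) simp
  hence "(\<lambda>n. complex_of_real (F $ n * x ^ n)) sums of_real (eval_fps F x)" by (simp only: sums_of_real_iff)
  thus ?thesis by (simp add: eval_fps_def sums_iff)
qed

lemma has_fps_expansion_at_0: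
  fixes f :: "real \<Rightarrow> real"
  assumes "f has_fps_expansion F"
  shows "f 0 = F $ 0"
proof -
  have "eventually (\<lambda>z. eval_fps F z = f z) (nhds 0)"
    using assms by (simp add: has_fps_expansion_def)
  hence "eval_fps F 0 = f 0" by (rule eventually_nhds_x_imp_x)
  thus ?thesis by (simp add: eval_fps_at_0)
qed

lemma has_fps_expansion_tendsto:
  fixes f :: "real \<Rightarrow> real"
  assumes "f has_fps_expansion F"
  shows "filterlim f (nhds (F $ 0)) (nhds 0)"
proof -
  have "isCont f 0" by (rule has_fps_expansion_imp_continuous[OF assms])
  hence "filterlim f (nhds (f 0)) (nhds 0)"
    unfolding isCont_def tendsto_at_iff_tendsto_nhds .
  thus ?thesis by (simp only: has_fps_expansion_at_0[OF assms])
qed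

lemma has_fps_expansion_real_compose:
  fixes f g :: "real \<Rightarrow> real"
  assumes f: "f has_fps_expansion F" and g: "g has_fps_expansion G" and G0: "G $ 0 = 0"
  shows "(\<lambda>x. f (g x)) has_fps_expansion (F oo G)"
proof -
  let ?F = "complexify F" and ?G = "complexify G" and ?H = "complexify (F oo G)"
  have rF: "fps_conv_radius F > 0" and rG: "fps_conv_radius G > 0"
    using f g by (simp_all add: has_fps_expansion_def)
  have "(eval_fps ?F \<circ> eval_fps ?G) has_fps_expansion ?H"
    unfolding complexify_compose
    by (intro has_fps_expansion_compose eval_fps_has_fps_expansion) (simp_all add: rF rG G0)
  hence rH: "fps_conv_radius (F oo G) > 0"
    and ev: "eventually (\<lambda>z. eval_fps ?H z = eval_fps ?F (eval_fps ?G z)) (nhds 0)"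
    by (simp_all add: has_fps_expansion_def)
  have of_real_lim: "filterlim complex_of_real (nhds 0) (nhds 0)"
    using tendsto_of_real[OF filterlim_ident[of "nhds (0 :: real)"]] by simp
  have g_lim: "filterlim g (nhds 0) (nhds 0)"
    using has_fps_expansion_tendsto[OF g] by (simp only: G0)
  have small: "eventually (\<lambda>x. ereal \<bar>x\<bar> < r) (nhds (0::real))" if "r > 0" for r
  proof -
    have "eventually (\<lambda>x. x \<in> eball 0 r) (nhds (0::real))"
      by (rule eventually_nhds_in_open) (use that in \<open>simp_all add: zero_ereal_def\<close>)
    thus ?thesis by eventually_elim simp
  qed
  have "eventually (\<lambda>x. eval_fps (F oo G) x = f (g x)) (nhds 0)"
    using eventually_compose_filterlim[OF ev of_real_lim] small[OF rG] small[OF rH]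
      eventually_compose_filterlim[OF small[OF rF] g_lim]
      g[unfolded has_fps_expansion_def, THEN conjunct2]
      eventually_compose_filterlim[OF f[unfolded has_fps_expansion_def, THEN conjunct2] g_lim]
  proof eventually_elim
    case (elim x)
    have "complex_of_real (eval_fps (F oo G) x) = eval_fps ?F (eval_fps ?G (of_real x))"
      using elim(1) complexify_eval[OF elim(3)] by metis
    also have "\<dots> = eval_fps ?F (of_real (g x))"
      by (simp only: complexify_eval[OF elim(2)] elim(5))
    also have "\<dots> = of_real (f (g x))"
      by (simp only: complexify_eval[OF elim(4)] elim(6))
    finally show ?case by (simp only: of_real_eq_iff)
  qed
  with rH show ?thesis by (simp add: has_fps_expansion_def)
qed

lemma has_fps_expansion_real_dilation:
  fixes f :: "real \<Rightarrow> real"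
  assumes "f has_fps_expansion F"
  shows "(\<lambda>x. f (c * x)) has_fps_expansion (F oo (fps_const c * fps_X))"
  by (rule has_fps_expansion_real_compose[OF assms])
     (rule has_fps_expansion_cmult_left[OF has_fps_expansion_fps_X], simp)

section \<open>The Cauchy-Stieltjes condition as a power series identity\<close>

lemma has_fps_expansion_moment_generating:
  assumes \<mu>: "moment_measure \<mu> M"
  shows "(\<lambda>u. \<integral>x. 1 / (1 - x * u) \<partial>\<mu>) has_fps_expansion M"
proof (rule has_fps_expansionI)
  interpret real_distribution \<mu> using \<mu> by (simp add: moment_measure_def)
  obtain B where B: "B > 0" "AE x in \<mu>. \<bar>x\<bar> \<le> B" using \<mu> by (auto simp: moment_measure_def)
  have "eventually (\<lambda>u. dist u 0 < 1 / (2 * B)) (nhds (0 :: real))"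
    unfolding eventually_nhds_metric using B(1) by (intro exI[of _ "1 / (2 * B)"]) auto
  thus "eventually (\<lambda>u. (\<lambda>n. M $ n * u ^ n) sums (\<integral>x. 1 / (1 - x * u) \<partial>\<mu>)) (nhds 0)"
  proof eventually_elim
    case (elim u)
    have small: "\<bar>x * u\<bar> \<le> 1 / 2" if "\<bar>x\<bar> \<le> B" for x
    proof -
      have "\<bar>x * u\<bar> \<le> B * (1 / (2 * B))"
        unfolding abs_mult using that elim B(1) by (intro mult_mono) (auto simp: dist_norm)
      thus ?thesis using B(1) by simp
    qed
    let ?f = "\<lambda>n x. x ^ n * u ^ n"
    have int: "integrable \<mu> (?f n)" for n
      by (intro integrable_mult_left moment_measure_integrable_power[OF \<mu>])
    have "(\<lambda>n. \<integral>x. ?f n x \<partial>\<mu>) sums (\<integral>x. (\<Sum>n. ?f n x) \<partial>\<mu>)"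
    proof (rule sums_integral[OF int])
      show "AE x in \<mu>. summable (\<lambda>n. norm (?f n x))"
        using B(2)
      proof eventually_elim
        case (elim x)
        have "summable (\<lambda>n. \<bar>x * u\<bar> ^ n)" using small[OF elim] by (intro summable_geometric) simp
        thus ?case by (simp add: power_mult_distrib abs_mult power_abs)
      qed
      show "summable (\<lambda>n. \<integral>x. norm (?f n x) \<partial>\<mu>)"
      proof (rule summable_comparison_test')
        show "summable (\<lambda>n. (1 / 2 :: real) ^ n)" by (rule summable_geometric) simp
        fix n
        have "(\<integral>x. norm (?f n x) \<partial>\<mu>) \<le> (\<integral>x. (1 / 2) ^ n \<partial>\<mu>)"
        proof (rule integral_mono_AE)
          show "AE x in \<mu>. norm (?f n x) \<le> (1 / 2) ^ n"
            using B(2)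
          proof eventually_elim
            case (elim x)
            have "\<bar>x * u\<bar> ^ n \<le> (1 / 2) ^ n" by (intro power_mono small elim) simp
            thus ?case by (simp add: power_mult_distrib abs_mult power_abs)
          qed
        qed (use int in \<open>auto intro: integrable_norm\<close>)
        thus "norm (\<integral>x. norm (?f n x) \<partial>\<mu>) \<le> (1 / 2) ^ n"
          using prob_space by simp
      qed
    qed
    also have "(\<integral>x. (\<Sum>n. ?f n x) \<partial>\<mu>) = (\<integral>x. 1 / (1 - x * u) \<partial>\<mu>)"
    proof (rule integral_cong_AE)
      show "AE x in \<mu>. (\<Sum>n. ?f n x) = 1 / (1 - x * u)"
        using B(2)
      proof eventually_elim
        case (elim x)
        have "norm (x * u) < 1" using small[OF elim] by simp
        thus ?case using suminf_geometric[of "x * u"] by (simp add: power_mult_distrib)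
      qed
    qed simp_all
    also have "(\<lambda>n. \<integral>x. ?f n x \<partial>\<mu>) = (\<lambda>n. M $ n * u ^ n)"
      using \<mu> by (simp add: moment_measure_def)
    finally show ?case .
  qed
qed

text \<open>
  With \<open>u = m / (V(m) + m\<^sup>2)\<close> the density equals \<open>(1 - m u) / (1 - x u)\<close>, so its integral is
  \<open>h(m) = (1 - m u) M(u)\<close>, and for small \<open>m\<close> it is nonnegative on the support of \<open>\<nu>\<close>. The members are
  probability measures near \<open>m = 0\<close> iff \<open>h = 1\<close> there, which is an identity of power series.
\<close>

lemma csk_members_iff:
  assumes \<nu>: "moment_measure \<nu> M" and V: "V has_fps_expansion F" and F0: "F $ 0 \<noteq> 0"
  defines "U \<equiv> fps_X * inverse (F + fps_X\<^sup>2)"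
  shows "(\<exists>m1 m2. m1 < 0 \<and> 0 < m2 \<and> (\<forall>m\<in>{m1<..<m2}. csk_member_prob \<nu> V m)) \<longleftrightarrow>
         (M oo U) * (1 - fps_X * U) = 1"
proof -
  interpret real_distribution \<nu> using \<nu> by (simp add: moment_measure_def)
  obtain B where B: "B > 0" "AE x in \<nu>. \<bar>x\<bar> \<le> B" using \<nu> by (auto simp: moment_measure_def)
  define g where "g u = (\<integral>x. 1 / (1 - x * u) \<partial>\<nu>)" for u
  \<comment> \<open>this \<open>u\<close> makes \<open>V m + m * (m - x) = (V m + m\<^sup>2) * (1 - x * u m)\<close>\<close>
  define u where "u m = m * inverse (V m + m ^ 2)" for m
  define h where "h m = g (u m) * (1 - m * u m)" for m
  have u_exp: "u has_fps_expansion U"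
    unfolding u_def U_def
    by (intro has_fps_expansion_mult has_fps_expansion_inverse has_fps_expansion_add V
          has_fps_expansion_fps_X has_fps_expansion_fps_X_power) (use F0 in simp)
  have "(\<lambda>m. g (u m)) has_fps_expansion (M oo U)"
    unfolding g_def
    by (rule has_fps_expansion_real_compose[OF has_fps_expansion_moment_generating[OF \<nu>] u_exp])
       (simp add: U_def)
  hence h_exp: "h has_fps_expansion (M oo U) * (1 - fps_X * U)"
    unfolding h_def
    by (intro has_fps_expansion_mult has_fps_expansion_diff has_fps_expansion_1 has_fps_expansion_fps_X u_exp)
  have [measurable]: "(\<lambda>x. csk_density V x m) \<in> borel_measurable \<nu>" for m
    unfolding csk_density_def by measurable
  have V_ne: "eventually (\<lambda>m. V m + m\<^sup>2 \<noteq> 0) (nhds 0)"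
  proof (rule tendsto_imp_eventually_ne)
    have "(\<lambda>m. V m + m\<^sup>2) has_fps_expansion F + fps_X\<^sup>2"
      by (intro has_fps_expansion_add V has_fps_expansion_fps_X_power)
    from has_fps_expansion_tendsto[OF this] show "filterlim (\<lambda>m. V m + m\<^sup>2) (nhds (F $ 0)) (nhds 0)"
      by simp
  qed (rule F0)
  have factor_pos: "eventually (\<lambda>m. 1 - m * u m > 0) (nhds 0)"
  proof (rule order_tendstoD(1))
    have "(\<lambda>m. 1 - m * u m) has_fps_expansion 1 - fps_X * U"
      by (intro has_fps_expansion_diff has_fps_expansion_mult has_fps_expansion_1 has_fps_expansion_fps_X u_exp)
    from has_fps_expansion_tendsto[OF this] show "filterlim (\<lambda>m. 1 - m * u m) (nhds 1) (nhds 0)"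
      by simp
  qed simp
  have "filterlim (\<lambda>m. u m) (nhds 0) (nhds 0)"
    using has_fps_expansion_tendsto[OF u_exp] by (simp add: U_def)
  hence u_small: "eventually (\<lambda>m. dist (u m) 0 < 1 / B) (nhds 0)"
    by (rule tendstoD) (use B(1) in simp)
  have near: "eventually (\<lambda>m. (AE x in \<nu>. 0 \<le> csk_density V x m) \<and> (\<integral>x. csk_density V x m \<partial>\<nu>) = h m) (nhds 0)"
    using V_ne factor_pos u_small
  proof eventually_elim
    case (elim m)
    have pos: "1 - x * u m > 0" if "\<bar>x\<bar> \<le> B" for x
    proof -
      have "x * u m \<le> \<bar>x\<bar> * \<bar>u m\<bar>" by (metis abs_ge_self abs_mult)
      also have "\<dots> \<le> B * \<bar>u m\<bar>" by (rule mult_right_mono) (use that in auto)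
      also have "\<dots> < B * (1 / B)" using elim(3) B(1) by (intro mult_strict_left_mono) (auto simp: dist_norm)
      finally show ?thesis using B(1) by simp
    qed
    have density: "csk_density V x m = (1 - m * u m) * (1 / (1 - x * u m))" if "\<bar>x\<bar> \<le> B" for x
    proof (cases "m = 0")
      case False
      have "V m + m * (m - x) = (V m + m\<^sup>2) * (1 - x * u m)" and "V m = (V m + m\<^sup>2) * (1 - m * u m)"
        using elim(1) by (simp_all add: u_def field_simps power2_eq_square)
      hence "V m / (V m + m * (m - x)) = ((V m + m\<^sup>2) * (1 - m * u m)) / ((V m + m\<^sup>2) * (1 - x * u m))"
        by simp
      thus ?thesis using False elim(1) by (simp add: csk_density_def)
    qed (simp add: csk_density_def u_def)
    have "AE x in \<nu>. 0 \<le> csk_density V x m"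
      using B(2) by eventually_elim (use pos elim(2) in \<open>auto simp: density less_imp_le\<close>)
    moreover have "(\<integral>x. csk_density V x m \<partial>\<nu>) = (\<integral>x. (1 - m * u m) * (1 / (1 - x * u m)) \<partial>\<nu>)"
    proof (rule integral_cong_AE)
      show "AE x in \<nu>. csk_density V x m = (1 - m * u m) * (1 / (1 - x * u m))"
        using B(2) by eventually_elim (rule density)
    qed simp_all
    hence "(\<integral>x. csk_density V x m \<partial>\<nu>) = h m"
      unfolding h_def g_def by (simp only: integral_mult_right_zero mult.commute)
    ultimately show ?case by blast
  qed
  have member: "csk_member_prob \<nu> V m \<longleftrightarrow> h m = 1"
    if m: "(AE x in \<nu>. 0 \<le> csk_density V x m) \<and> (\<integral>x. csk_density V x m \<partial>\<nu>) = h m" for m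
  proof -
    let ?P = "density \<nu> (\<lambda>x. ennreal (csk_density V x m))"
    have "emeasure ?P (space \<nu>) = (\<integral>\<^sup>+x. ennreal (csk_density V x m) * indicator (space \<nu>) x \<partial>\<nu>)"
      by (rule emeasure_density) simp_all
    also have "\<dots> = (\<integral>\<^sup>+x. ennreal (csk_density V x m) \<partial>\<nu>)"
      by (rule nn_integral_cong) simp
    finally have mass: "emeasure ?P (space ?P) = (\<integral>\<^sup>+x. ennreal (csk_density V x m) \<partial>\<nu>)"
      by simp
    have "prob_space ?P \<longleftrightarrow> emeasure ?P (space ?P) = 1"
      by (blast intro: prob_spaceI prob_space.emeasure_space_1)
    also have "\<dots> \<longleftrightarrow> (\<integral>\<^sup>+x. ennreal (csk_density V x m) \<partial>\<nu>) = 1"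
      by (simp only: mass)
    also have "\<dots> \<longleftrightarrow> h m = 1"
    proof
      assume "(\<integral>\<^sup>+x. ennreal (csk_density V x m) \<partial>\<nu>) = 1"
      moreover have "(\<integral>x. csk_density V x m \<partial>\<nu>) = enn2real (\<integral>\<^sup>+x. ennreal (csk_density V x m) \<partial>\<nu>)"
        by (rule integral_eq_nn_integral) (use m in auto)
      ultimately show "h m = 1" using m by simp
    next
      assume "h m = 1"
      \<comment> \<open>a function that is not integrable would have the default integral 0\<close>
      hence "integrable \<nu> (\<lambda>x. csk_density V x m)"
        using m not_integrable_integral_eq by fastforce
      thus "(\<integral>\<^sup>+x. ennreal (csk_density V x m) \<partial>\<nu>) = 1"
        using m \<open>h m = 1\<close> by (subst nn_integral_eq_integral) auto
    qed
    finally show ?thesis using m by (simp add: csk_member_prob_def)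
  qed
  have "(\<exists>m1 m2. m1 < 0 \<and> 0 < m2 \<and> (\<forall>m\<in>{m1<..<m2}. csk_member_prob \<nu> V m)) \<longleftrightarrow>
      eventually (\<lambda>m. csk_member_prob \<nu> V m) (nhds 0)"
  proof
    assume "\<exists>m1 m2. m1 < 0 \<and> 0 < m2 \<and> (\<forall>m\<in>{m1<..<m2}. csk_member_prob \<nu> V m)"
    then obtain m1 m2 where m: "m1 < 0" "0 < m2" "\<forall>m\<in>{m1<..<m2}. csk_member_prob \<nu> V m" by blast
    have "eventually (\<lambda>m. m \<in> {m1<..<m2}) (nhds 0)"
      by (rule eventually_nhds_in_open) (use m in auto)
    thus "eventually (\<lambda>m. csk_member_prob \<nu> V m) (nhds 0)"
      by eventually_elim (use m(3) in blast)
  next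
    assume "eventually (\<lambda>m. csk_member_prob \<nu> V m) (nhds 0)"
    then obtain d where "d > 0" "\<And>m. dist m 0 < d \<Longrightarrow> csk_member_prob \<nu> V m"
      unfolding eventually_nhds_metric by blast
    thus "\<exists>m1 m2. m1 < 0 \<and> 0 < m2 \<and> (\<forall>m\<in>{m1<..<m2}. csk_member_prob \<nu> V m)"
      by (intro exI[of _ "-d"] exI[of _ d]) (auto simp: dist_norm)
  qed
  also have "\<dots> \<longleftrightarrow> eventually (\<lambda>m. h m = 1) (nhds 0)"
  proof (rule eventually_cong)
    show "eventually (\<lambda>m. csk_member_prob \<nu> V m \<longleftrightarrow> h m = 1) (nhds 0)"
      using near by eventually_elim (rule member)
  qed
  also have "\<dots> \<longleftrightarrow> (M oo U) * (1 - fps_X * U) = 1"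
  proof
    assume "eventually (\<lambda>m. h m = 1) (nhds 0)"
    hence "eventually (\<lambda>m. eval_fps 1 m = h m) (nhds 0)"
      by eventually_elim simp
    hence "h has_fps_expansion 1"
      by (simp add: has_fps_expansion_def)
    thus "(M oo U) * (1 - fps_X * U) = 1"
      by (rule has_fps_expansion_real_unique[OF h_exp])
  next
    assume "(M oo U) * (1 - fps_X * U) = 1"
    hence "eventually (\<lambda>m. eval_fps 1 m = h m) (nhds 0)"
      using h_exp by (simp only: has_fps_expansion_def)
    thus "eventually (\<lambda>m. h m = 1) (nhds 0)"
      by eventually_elim simp
  qed
  finally show ?thesis .
qed

text \<open>
  Substituting \<open>M(U) = 1 / (1 - U\<^sup>2 T(U))\<close> turns the equation into \<open>U T(U) = z\<close>, so \<open>z T(z)\<close> and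
  \<open>U = z / (F + z\<^sup>2)\<close> are inverse to each other under composition. This is the functional equation of the
  free cumulants.
\<close>

lemma csk_equation_iff_free_moments:
  fixes F M T :: "real fps"
  assumes M: "M * (1 - fps_X\<^sup>2 * T) = 1" and T0: "T $ 0 = 1" and F0: "F $ 0 \<noteq> 0"
  defines "U \<equiv> fps_X * inverse (F + fps_X\<^sup>2)"
  shows "(M oo U) * (1 - fps_X * U) = 1 \<longleftrightarrow> (F + fps_X\<^sup>2) oo (fps_X * T) = T"
proof -
  have U0: "U $ 0 = 0" and U1: "U $ 1 \<noteq> 0" using F0 by (simp_all add: U_def)
  have MU: "(M oo U) * (1 - U\<^sup>2 * (T oo U)) = 1"
    using arg_cong[OF M, of "\<lambda>f. f oo U"] U0
    by (simp add: fps_compose_mult_distrib fps_compose_sub_distrib power2_eq_square)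
  have "M oo U \<noteq> 0" using MU by auto
  hence "(M oo U) * (1 - fps_X * U) = 1 \<longleftrightarrow> 1 - fps_X * U = 1 - U\<^sup>2 * (T oo U)"
    using MU by (metis mult_cancel_left)
  also have "\<dots> \<longleftrightarrow> U * fps_X = U * (U * (T oo U))"
    by (simp add: power2_eq_square mult.assoc mult.commute[of fps_X])
  also have "\<dots> \<longleftrightarrow> fps_X = U * (T oo U)"
    using U1 by auto
  also have "\<dots> \<longleftrightarrow> (fps_X * T) oo U = fps_X"
    using U0 by (auto simp: fps_compose_mult_distrib)
  also have "\<dots> \<longleftrightarrow> U oo (fps_X * T) = fps_X"
    using fps_compose_inverse_sym[of "fps_X * T" U] fps_compose_inverse_sym[of U "fps_X * T"] U0 U1 T0
    by auto
  also have "\<dots> \<longleftrightarrow> (F + fps_X\<^sup>2) oo (fps_X * T) = T"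
    unfolding U_def by (rule free_moments_iff_inverse[symmetric]) (use F0 in simp)
  finally show ?thesis .
qed

section \<open>Variance functions and free cumulants\<close>

lemma real_analytic_at_const: "real_analytic_at (\<lambda>x. c) a"
  unfolding real_analytic_at_def by (rule exI, rule has_fps_expansion_const)

lemma real_analytic_at_ident: "real_analytic_at (\<lambda>x. x) a"
  unfolding real_analytic_at_def
  by (rule exI, rule has_fps_expansion_add[OF has_fps_expansion_const has_fps_expansion_fps_X])

lemma real_analytic_at_add:
  "real_analytic_at f a \<Longrightarrow> real_analytic_at g a \<Longrightarrow> real_analytic_at (\<lambda>x. f x + g x) a"
  unfolding real_analytic_at_def by (elim exE) (rule exI, rule has_fps_expansion_add)

lemma real_analytic_at_diff:
  "real_analytic_at f a \<Longrightarrow> real_analytic_at g a \<Longrightarrow> real_analytic_at (\<lambda>x. f x - g x) a"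
  unfolding real_analytic_at_def by (elim exE) (rule exI, rule has_fps_expansion_diff)

lemma real_analytic_at_mult:
  "real_analytic_at f a \<Longrightarrow> real_analytic_at g a \<Longrightarrow> real_analytic_at (\<lambda>x. f x * g x) a"
  unfolding real_analytic_at_def by (elim exE) (rule exI, rule has_fps_expansion_mult)

lemmas real_analytic_at_intros =
  real_analytic_at_const real_analytic_at_ident real_analytic_at_add real_analytic_at_diff real_analytic_at_mult

lemma real_analytic_near_dilation:
  assumes "\<forall>\<^sub>F a in nhds 0. real_analytic_at V a"
  shows "\<forall>\<^sub>F a in nhds 0. real_analytic_at (\<lambda>m. V (c * m)) a"
proof -
  have "filterlim (\<lambda>a :: real. c * a) (nhds 0) (nhds 0)"
    using tendsto_mult_left[OF filterlim_ident[of "nhds (0 :: real)"], of c] by simp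
  from eventually_compose_filterlim[OF assms this] show ?thesis
  proof eventually_elim
    case (elim a)
    then obtain G where "(\<lambda>h. V (c * a + h)) has_fps_expansion G"
      by (auto simp: real_analytic_at_def)
    from has_fps_expansion_real_dilation[OF this, of c] show ?case
      unfolding real_analytic_at_def by (auto simp: distrib_left)
  qed
qed

text \<open>
  The law of which \<open>F + z\<^sup>2\<close> is the cumulant series is not \<open>\<nu>\<close> itself but the one with moment series \<open>T\<close>,
  the first continued fraction step below \<open>\<nu>\<close>; mean 0 and variance 1 of \<open>\<nu>\<close> mean that this step
  has the parameters \<open>a = 0\<close> and \<open>b = 1\<close>.
\<close>

theorem variance_class_iff:
  "V \<in> variance_class \<longleftrightarrow> (\<forall>\<^sub>F a in nhds 0. real_analytic_at V a) \<and>
     (\<exists>F. V has_fps_expansion F \<and> F + fps_X\<^sup>2 \<in> free_cumulant_class)"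
proof (intro iffI conjI)
  assume "V \<in> variance_class"
  then obtain \<nu> where \<nu>: "real_distribution \<nu>" "compactly_supported \<nu>"
    and mean: "(\<integral>x. x \<partial>\<nu>) = 0" and var: "(\<integral>x. x\<^sup>2 \<partial>\<nu>) = 1" and vf: "variance_function \<nu> V"
    by (auto simp: variance_class_def)
  show an: "\<forall>\<^sub>F a in nhds 0. real_analytic_at V a" using vf by (simp add: variance_function_def)
  hence "real_analytic_at V 0" by (rule eventually_nhds_x_imp_x)
  then obtain F where F: "V has_fps_expansion F" by (auto simp: real_analytic_at_def)
  define M where "M = Abs_fps (\<lambda>n. \<integral>x. x ^ n \<partial>\<nu>)"
  obtain K where K: "compact K" "AE x in \<nu>. x \<in> K" using \<nu>(2) by (auto simp: compactly_supported_def)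
  obtain B where "B > 0" "\<And>x. x \<in> K \<Longrightarrow> norm x \<le> B"
    using compact_imp_bounded[OF K(1)] bounded_pos by metis
  hence "AE x in \<nu>. \<bar>x\<bar> \<le> B" using K(2) by (auto elim!: eventually_mono)
  hence mm: "moment_measure \<nu> M" using \<nu>(1) \<open>B > 0\<close> by (auto simp: moment_measure_def M_def)
  obtain a b T where T: "positive_moments T" "a = M $ 1" "b = M $ 2 - (M $ 1)\<^sup>2"
    "M * (1 - fps_const a * fps_X - fps_const b * fps_X\<^sup>2 * T) = 1"
    using positive_moments_obtain_first_return[OF moment_measure_imp_positive_moments[OF mm]] by metis
  have T_eq: "M * (1 - fps_X\<^sup>2 * T) = 1"
    using T(2-4) mean var by (simp add: M_def)
  have F0: "F $ 0 \<noteq> 0" using vf has_fps_expansion_at_0[OF F] by (simp add: variance_function_def)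
  show "\<exists>F. V has_fps_expansion F \<and> F + fps_X\<^sup>2 \<in> free_cumulant_class"
  proof -
    have "(F + fps_X\<^sup>2) oo (fps_X * T) = T"
      using vf csk_members_iff[OF mm F F0] csk_equation_iff_free_moments[OF T_eq positive_moments_0[OF T(1)] F0]
      by (simp add: variance_function_def)
    moreover have "fps_conv_radius (F + fps_X\<^sup>2) > 0"
      using F by (intro fps_conv_radius_add_pos) (auto simp: has_fps_expansion_def)
    ultimately have "F + fps_X\<^sup>2 \<in> free_cumulant_class"
      using T(1) by (intro free_cumulant_classI)
    with F show ?thesis by blast
  qed
next
  assume "(\<forall>\<^sub>F a in nhds 0. real_analytic_at V a) \<and> (\<exists>F. V has_fps_expansion F \<and> F + fps_X\<^sup>2 \<in> free_cumulant_class)"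
  then obtain F where an: "\<forall>\<^sub>F a in nhds 0. real_analytic_at V a" and F: "V has_fps_expansion F"
    and C: "F + fps_X\<^sup>2 \<in> free_cumulant_class" by blast
  obtain T where T: "positive_moments T" "(F + fps_X\<^sup>2) oo (fps_X * T) = T" and
    rC: "fps_conv_radius (F + fps_X\<^sup>2) > 0"
    using C by (auto simp: free_cumulant_class_def)
  have rT: "fps_conv_radius T > 0" by (rule fps_conv_radius_free_moments[OF rC T(2)])
  have F0: "F $ 0 = 1" using free_cumulant_class_nth_0[OF C] by simp
  define M where "M = inverse (1 - fps_X\<^sup>2 * T)"
  have M_eq: "M * (1 - fps_X\<^sup>2 * T) = 1"
    unfolding M_def by (rule inverse_mult_eq_1) simp
  hence M_rec: "M * (1 - fps_const 0 * fps_X - fps_const 1 * fps_X\<^sup>2 * T) = 1" by simp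
  have M: "positive_moments M"
    by (rule positive_moments_first_return[OF T(1) _ M_rec]) simp
  have "fps_conv_radius M > 0"
    unfolding M_def
    by (intro fps_conv_radius_inverse_pos fps_conv_radius_diff_pos fps_conv_radius_mult_pos rT) simp_all
  then obtain \<nu> where \<nu>: "moment_measure \<nu> M" using bounded_Hamburger[OF M] by blast
  have M12: "M $ 1 = 0" "M $ 2 = 1"
    using M_rec positive_moments_0[OF T(1)] unfolding first_return_recursion by (simp_all add: numeral_2_eq_2)
  have "variance_function \<nu> V"
    unfolding variance_function_def
    using an F0 has_fps_expansion_at_0[OF F] csk_members_iff[OF \<nu> F]
      csk_equation_iff_free_moments[OF M_eq positive_moments_0[OF T(1)], of F] T(2) by simp
  moreover have "compactly_supported \<nu>"
  proof -
    obtain B where "AE x in \<nu>. \<bar>x\<bar> \<le> B" using \<nu> by (auto simp: moment_measure_def)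
    hence "AE x in \<nu>. x \<in> {-B..B}" by eventually_elim auto
    thus ?thesis unfolding compactly_supported_def by (intro exI[of _ "{-B..B}"]) auto
  qed
  moreover have "(\<integral>x. x ^ 1 \<partial>\<nu>) = 0" "(\<integral>x. x ^ 2 \<partial>\<nu>) = 1"
    using \<nu> M12 unfolding moment_measure_def by metis+
  ultimately show "V \<in> variance_class"
    using \<nu> by (auto simp: variance_class_def moment_measure_def)
qed

text \<open>
  If \<open>V(c m)\<close> is a variance function, then undoing the dilation shows that \<open>F + z\<^sup>2 / c\<^sup>2\<close> is a cumulant
  series; let \<open>c\<close> tend to infinity. Conversely, cumulant series are closed under dilations, and adding the
  semicircle law of variance 1 contributes the term \<open>z\<^sup>2\<close>.
\<close>

theorem variance_class_inf_iff:
  "V \<in> variance_class_inf \<longleftrightarrow> (\<forall>\<^sub>F a in nhds 0. real_analytic_at V a) \<and>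
     (\<exists>F. V has_fps_expansion F \<and> F \<in> free_cumulant_class)"
proof (intro iffI conjI)
  assume inf: "V \<in> variance_class_inf"
  hence V: "V \<in> variance_class" and dil: "\<And>c. (\<lambda>m. V (c * m)) \<in> variance_class"
    by (auto simp: variance_class_inf_def)
  show "\<forall>\<^sub>F a in nhds 0. real_analytic_at V a" using V by (simp add: variance_class_iff)
  obtain F where F: "V has_fps_expansion F" using V by (auto simp: variance_class_iff)
  have member: "F + fps_const (1 / c\<^sup>2) * fps_X\<^sup>2 \<in> free_cumulant_class" if "c \<noteq> 0" for c
  proof -
    let ?c = "fps_const c * fps_X" and ?d = "fps_const (1 / c) * fps_X"
    obtain G where "(\<lambda>m. V (c * m)) has_fps_expansion G" "G + fps_X\<^sup>2 \<in> free_cumulant_class"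
      using dil[of c] by (auto simp: variance_class_iff)
    moreover have "(\<lambda>m. V (c * m)) has_fps_expansion (F oo ?c)"
      by (rule has_fps_expansion_real_dilation[OF F])
    ultimately have "(F oo ?c) + fps_X\<^sup>2 \<in> free_cumulant_class"
      using has_fps_expansion_real_unique by metis
    hence "((F oo ?c) + fps_X\<^sup>2) oo ?d \<in> free_cumulant_class"
      by (rule free_cumulant_class_dilation)
    also have "((F oo ?c) + fps_X\<^sup>2) oo ?d = F + fps_const (1 / c\<^sup>2) * fps_X\<^sup>2"
    proof (rule fps_ext)
      fix n
      have "(((F oo ?c) + fps_X\<^sup>2) oo ?d) $ n = (1 / c) ^ n * (c ^ n * F $ n + fps_X\<^sup>2 $ n)"
        by (simp only: fps_compose_linear fps_nth_Abs_fps fps_add_nth)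
      also have "\<dots> = F $ n + 1 / c\<^sup>2 * fps_X\<^sup>2 $ n"
        using that by (auto simp: fps_X_power_nth field_simps)
      finally show "(((F oo ?c) + fps_X\<^sup>2) oo ?d) $ n = (F + fps_const (1 / c\<^sup>2) * fps_X\<^sup>2) $ n"
        by simp
    qed
    finally show ?thesis .
  qed
  have "F \<in> free_cumulant_class"
  proof (rule free_cumulant_class_LIMSEQ)
    show "fps_conv_radius F > 0" using F by (simp add: has_fps_expansion_def)
    show "F + fps_const (1 / (real (Suc k))\<^sup>2) * fps_X\<^sup>2 \<in> free_cumulant_class" for k
      by (rule member) simp
    fix n
    have "(\<lambda>k. 1 / (real (Suc k))\<^sup>2) \<longlonglongrightarrow> 0" by real_asymp
    hence "(\<lambda>k. F $ n + 1 / (real (Suc k))\<^sup>2 * fps_X\<^sup>2 $ n) \<longlonglongrightarrow> F $ n + 0 * fps_X\<^sup>2 $ n"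
      by (intro tendsto_intros)
    thus "(\<lambda>k. (F + fps_const (1 / (real (Suc k))\<^sup>2) * fps_X\<^sup>2) $ n) \<longlonglongrightarrow> F $ n"
      by (simp only: fps_add_nth fps_mult_left_const_nth mult_zero_left add_0_right)
  qed
  with F show "\<exists>F. V has_fps_expansion F \<and> F \<in> free_cumulant_class" by blast
next
  assume "(\<forall>\<^sub>F a in nhds 0. real_analytic_at V a) \<and> (\<exists>F. V has_fps_expansion F \<and> F \<in> free_cumulant_class)"
  then obtain F where an: "\<forall>\<^sub>F a in nhds 0. real_analytic_at V a"
    and F: "V has_fps_expansion F" "F \<in> free_cumulant_class" by blast
  have in_class: "W \<in> variance_class"
    if "\<forall>\<^sub>F a in nhds 0. real_analytic_at W a" "W has_fps_expansion G" "G \<in> free_cumulant_class" for W G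
  proof -
    have "G + (1 + fps_const 1 * fps_X\<^sup>2) - 1 \<in> free_cumulant_class"
      by (rule free_cumulant_class_add[OF that(3) free_cumulant_class_semicircle]) simp
    thus ?thesis using that by (auto simp: variance_class_iff)
  qed
  have "(\<lambda>m. V (c * m)) \<in> variance_class" for c
    by (rule in_class[OF real_analytic_near_dilation[OF an] has_fps_expansion_real_dilation[OF F(1)]
          free_cumulant_class_dilation[OF F(2)]])
  thus "V \<in> variance_class_inf"
    using in_class[OF an F] by (simp add: variance_class_inf_def)
qed

theorem theorem1p1:
  fixes V V1 V2 :: "real \<Rightarrow> real" and c :: real
  assumes "V \<in> variance_class"
    and "V1 \<in> variance_class_inf"
    and "V2 \<in> variance_class_inf"
    and "c \<ge> 1"
  shows "((\<lambda>m. V (m / c)) \<in> variance_class) \<and>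
    (\<forall>a. (\<lambda>m. V m + a * m) \<in> variance_class \<and> (\<lambda>m. V1 m + a * m) \<in> variance_class_inf) \<and>
    ((\<lambda>m. V1 m + V2 m - 1) \<in> variance_class_inf \<and>
      (\<lambda>m. c * V1 m - c + 1) \<in> variance_class_inf) \<and>
    ((\<lambda>m. V1 m - m\<^sup>2) \<in> variance_class) \<and>
    ((\<lambda>m. V m + m\<^sup>2) \<in> variance_class_inf)"
proof -
  obtain F where an: "\<forall>\<^sub>F a in nhds 0. real_analytic_at V a"
    and F: "V has_fps_expansion F" "F + fps_X\<^sup>2 \<in> free_cumulant_class"
    using assms(1) unfolding variance_class_iff by blast
  obtain F1 where an1: "\<forall>\<^sub>F a in nhds 0. real_analytic_at V1 a"
    and F1: "V1 has_fps_expansion F1" "F1 \<in> free_cumulant_class"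
    using assms(2) unfolding variance_class_inf_iff by blast
  obtain F2 where an2: "\<forall>\<^sub>F a in nhds 0. real_analytic_at V2 a"
    and F2: "V2 has_fps_expansion F2" "F2 \<in> free_cumulant_class"
    using assms(3) unfolding variance_class_inf_iff by blast
  have translate: "C + fps_const a * fps_X \<in> free_cumulant_class" if "C \<in> free_cumulant_class" for C a
    using free_cumulant_class_add[OF that free_cumulant_class_dirac[of a]] by (simp add: algebra_simps)
  have linear: "(\<lambda>m. a * m) has_fps_expansion fps_const a * fps_X" for a :: real
    by (rule has_fps_expansion_cmult_left[OF has_fps_expansion_fps_X])
  have square: "(\<lambda>m :: real. m\<^sup>2) has_fps_expansion fps_X\<^sup>2"
    by (rule has_fps_expansion_fps_X_power)
  have square_analytic: "real_analytic_at (\<lambda>m. m\<^sup>2) a" for a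
    unfolding power2_eq_square by (intro real_analytic_at_intros)

  \<comment> \<open>the dilation leaves \<open>m\<^sup>2/c\<^sup>2\<close>; the semicircle law supplies the rest of \<open>m\<^sup>2\<close>\<close>
  have "(\<lambda>m. V (1 / c * m)) \<in> variance_class"
    unfolding variance_class_iff
  proof (intro conjI exI)
    let ?d = "fps_const (1 / c) * fps_X"
    show "\<forall>\<^sub>F a in nhds 0. real_analytic_at (\<lambda>m. V (1 / c * m)) a"
      by (rule real_analytic_near_dilation[OF an])
    show "(\<lambda>m. V (1 / c * m)) has_fps_expansion (F oo ?d)"
      by (rule has_fps_expansion_real_dilation[OF F(1)])
    have "1 - (1 / c)\<^sup>2 \<ge> 0" using assms(4) by (simp add: power_le_one)
    hence "((F + fps_X\<^sup>2) oo ?d) + (1 + fps_const (1 - (1 / c)\<^sup>2) * fps_X\<^sup>2) - 1 \<in> free_cumulant_class"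
      by (intro free_cumulant_class_add free_cumulant_class_dilation F free_cumulant_class_semicircle)
    also have "((F + fps_X\<^sup>2) oo ?d) + (1 + fps_const (1 - (1 / c)\<^sup>2) * fps_X\<^sup>2) - 1 = (F oo ?d) + fps_X\<^sup>2"
    proof -
      have "fps_X\<^sup>2 oo ?d = fps_const ((1 / c)\<^sup>2) * fps_X\<^sup>2"
        by (simp add: power2_eq_square fps_compose_mult_distrib mult_ac flip: fps_const_mult)
      thus ?thesis
        by (simp add: fps_compose_add_distrib algebra_simps flip: fps_const_sub)
    qed
    finally show "(F oo ?d) + fps_X\<^sup>2 \<in> free_cumulant_class" .
  qed
  moreover have "(\<lambda>m. V m + a * m) \<in> variance_class" for a
    unfolding variance_class_iff
  proof (intro conjI exI)
    show "\<forall>\<^sub>F x in nhds 0. real_analytic_at (\<lambda>m. V m + a * m) x"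
      using an by eventually_elim (intro real_analytic_at_intros)
    show "(\<lambda>m. V m + a * m) has_fps_expansion F + fps_const a * fps_X"
      by (rule has_fps_expansion_add[OF F(1) linear])
    show "F + fps_const a * fps_X + fps_X\<^sup>2 \<in> free_cumulant_class"
      using translate[OF F(2), of a] by (simp add: add_ac)
  qed
  moreover have "(\<lambda>m. V1 m + a * m) \<in> variance_class_inf" for a
    unfolding variance_class_inf_iff
  proof (intro conjI exI)
    show "\<forall>\<^sub>F x in nhds 0. real_analytic_at (\<lambda>m. V1 m + a * m) x"
      using an1 by eventually_elim (intro real_analytic_at_intros)
    show "(\<lambda>m. V1 m + a * m) has_fps_expansion F1 + fps_const a * fps_X"
      by (rule has_fps_expansion_add[OF F1(1) linear])
  qed (rule translate[OF F1(2)])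
  moreover have "(\<lambda>m. V1 m + V2 m - 1) \<in> variance_class_inf"
    unfolding variance_class_inf_iff
  proof (intro conjI exI)
    show "\<forall>\<^sub>F x in nhds 0. real_analytic_at (\<lambda>m. V1 m + V2 m - 1) x"
      using an1 an2 by eventually_elim (intro real_analytic_at_intros)
    show "(\<lambda>m. V1 m + V2 m - 1) has_fps_expansion F1 + F2 - 1"
      by (intro has_fps_expansion_add has_fps_expansion_diff F1 F2 has_fps_expansion_1)
  qed (rule free_cumulant_class_add[OF F1(2) F2(2)])
  moreover have "(\<lambda>m. c * V1 m - c + 1) \<in> variance_class_inf"
    unfolding variance_class_inf_iff
  proof (intro conjI exI)
    show "\<forall>\<^sub>F x in nhds 0. real_analytic_at (\<lambda>m. c * V1 m - c + 1) x"
      using an1 by eventually_elim (intro real_analytic_at_intros)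
    show "(\<lambda>m. c * V1 m - c + 1) has_fps_expansion fps_const c * F1 - fps_const c + 1"
      by (intro has_fps_expansion_add has_fps_expansion_diff has_fps_expansion_cmult_left F1
            has_fps_expansion_const has_fps_expansion_1)
    show "fps_const c * F1 - fps_const c + 1 \<in> free_cumulant_class"
      using free_cumulant_class_power[OF F1(2) assms(4)] by (simp add: algebra_simps flip: fps_const_sub)
  qed
  moreover have "(\<lambda>m. V1 m - m\<^sup>2) \<in> variance_class"
    unfolding variance_class_iff
  proof (intro conjI exI)
    show "\<forall>\<^sub>F x in nhds 0. real_analytic_at (\<lambda>m. V1 m - m\<^sup>2) x"
      using an1 by eventually_elim (intro real_analytic_at_diff square_analytic)
    show "(\<lambda>m. V1 m - m\<^sup>2) has_fps_expansion F1 - fps_X\<^sup>2"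
      by (rule has_fps_expansion_diff[OF F1(1) square])
  qed (simp add: F1(2))
  moreover have "(\<lambda>m. V m + m\<^sup>2) \<in> variance_class_inf"
    unfolding variance_class_inf_iff
  proof (intro conjI exI)
    show "\<forall>\<^sub>F x in nhds 0. real_analytic_at (\<lambda>m. V m + m\<^sup>2) x"
      using an by eventually_elim (intro real_analytic_at_add square_analytic)
    show "(\<lambda>m. V m + m\<^sup>2) has_fps_expansion F + fps_X\<^sup>2"
      by (rule has_fps_expansion_add[OF F(1) square])
  qed (rule F(2))
  ultimately show ?thesis by simp
qed

end
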